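(* Let $g(x)=e^{x+1}\int_{x+1}^{\infty}\frac{e^{-y}}{y}\,dy$ for $x\ge 0$. There is an absolute constant $C>0$ such that, on every instance of the online stochastic rewards problem, the expected total reward of Algorithm 2 (Generalized Fully-Adaptive) run with this $g$ is at least $(1-C\sqrt{p_{\max}})\,g(0)$ times the optimal expected reward of any fully offline policy (and hence of any clairvoyant policy), where $p_{\max}=\max_{(i,t)\in E}p_{it}$. Moreover $g(0)>0.596$.
   Context: Online stochastic rewards problem: a bipartite graph $G=(I,T,E)$; offline vertices (resources) $i\in I$ are known in advance, each has a reward $r_i>0$ and unit capacity. Online vertices (arrivals) $t\in T$ arrive one at a time in the order $t=1,2,\dots$; when $t$ arrives, its incident edges $(i,t)\in E$ and their success probabilities $p_{it}\in[0,1]$ are revealed. The algorithm must then irrevocably offer $t$ at most one currently available neighbour $i$. The offer succeeds with probability $p_{it}$, independently of everything else; if it succeeds the algorithm earns $r_i$ and $i$ becomes unavailable forever, otherwise $i$ stays available. The outcome is revealed only after the offer is made. The goal is to maximize expected total reward. Benchmarks: a clairvoyant policy knows $G$, all $p_{it}$ and $r_i$ in advance, processes arrivals in the order $1,2,\dots$, offers each arrival at most one available resource, and learns the outcome of each offer only after making it. A fully offline policy has the same knowledge and constraints but may adaptively choose the order in which arrivals are processed. Algorithm 2 (Generalized Fully-Adaptive) with scaling function $g:[0,\infty)\to[0,1]$: initially all resources are available and $l_i=0$ for all $i$. When $t$ arrives, offer $t$ the available neighbour $i^*$ maximizing $p_{it}r_ig(l_i)$ (if any); if $t$ accepts, $i^*$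 becomes unavailable; otherwise set $l_{i^*}\leftarrow l_{i^*}+p_{i^*t}$. *)

theory Defs
  imports "HOL-Analysis.Analysis"
begin

text \<open>Instance: resources 0..<n, arrivals 0..<m, edge set E, probabilities p i t, rewards r i.
  A history records, for every processed arrival, the arrival index, the offered resource
  (None = no offer) and the outcome of the offer (True = accepted).\<close>

type_synonym history = "(nat \<times> nat option \<times> bool) list"

text \<open>A (possibly adaptive) policy maps the observed history to the next action:
  the arrival to process next and the resource offered to it (if any).\<close>

type_synonym policy = "history \<Rightarrow> nat \<times> nat option"

definition processed :: "history \<Rightarrow> nat set" where
  "processed h = fst ` set h"

definition avail :: "nat \<Rightarrow> history \<Rightarrow> nat set" where
  "avail n h = {i. i < n} - {i. \<exists>t. (t, Some i, True) \<in> set h}"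

text \<open>Expected total reward collected by policy pi from history h, with k steps remaining.
  Invalid actions (processing an already processed or non-existent arrival, or offering an
  unavailable / non-adjacent resource) terminate the run with no further reward.\<close>

fun pval :: "nat \<Rightarrow> nat \<Rightarrow> (nat \<times> nat) set \<Rightarrow> (nat \<Rightarrow> nat \<Rightarrow> real) \<Rightarrow> (nat \<Rightarrow> real)
    \<Rightarrow> nat \<Rightarrow> policy \<Rightarrow> history \<Rightarrow> real" where
  "pval n m E p r 0 pol h = 0"
| "pval n m E p r (Suc k) pol h =
     (if {..<m} - processed h = {} then 0 else
      (case pol h of (t, a) \<Rightarrow>
        if t \<notin> {..<m} - processed h then 0 else
        (case a of
          None \<Rightarrow> pval n m E p r k pol (h @ [(t, None, False)])
        | Some i \<Rightarrow>
            if i \<in> avail n h \<and> (i, t) \<in> E then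
              p i t * (r i + pval n m E p r k pol (h @ [(t, Some i, True)]))
              + (1 - p i t) * pval n m E p r k pol (h @ [(t, Some i, False)])
            else 0)))"

definition exp_reward :: "nat \<Rightarrow> nat \<Rightarrow> (nat \<times> nat) set \<Rightarrow> (nat \<Rightarrow> nat \<Rightarrow> real) \<Rightarrow> (nat \<Rightarrow> real)
    \<Rightarrow> policy \<Rightarrow> real" where
  "exp_reward n m E p r pol = pval n m E p r m pol []"

definition clairvoyant :: "policy \<Rightarrow> bool" where
  "clairvoyant pol \<longleftrightarrow> (\<forall>h. fst (pol h) = length h)"

definition load :: "(nat \<Rightarrow> nat \<Rightarrow> real) \<Rightarrow> history \<Rightarrow> nat \<Rightarrow> real" where
  "load p h i = sum_list (map (\<lambda>(t, a, s). if a = Some i \<and> \<not> s then p i t else 0) h)"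

text \<open>Algorithm 2 (Generalized Fully-Adaptive) with scaling function g, with an arbitrary
  tie-breaking rule: arrivals are processed in order, and arrival t is offered an available
  neighbour maximizing p_it r_i g(l_i), if any.\<close>

definition alg2 :: "nat \<Rightarrow> (nat \<times> nat) set \<Rightarrow> (nat \<Rightarrow> nat \<Rightarrow> real) \<Rightarrow> (nat \<Rightarrow> real)
    \<Rightarrow> (real \<Rightarrow> real) \<Rightarrow> policy \<Rightarrow> bool" where
  "alg2 n E p r g pol \<longleftrightarrow>
     (\<forall>h. let t = length h; N = {i \<in> avail n h. (i, t) \<in> E} in
        fst (pol h) = t \<and>
        (N = {} \<longrightarrow> snd (pol h) = None) \<and>
        (N \<noteq> {} \<longrightarrow> (\<exists>i. snd (pol h) = Some i \<and> i \<in> N \<and>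
            (\<forall>j \<in> N. p j t * r j * g (load p h j) \<le> p i t * r i * g (load p h i)))))"

definition pmax :: "(nat \<times> nat) set \<Rightarrow> (nat \<Rightarrow> nat \<Rightarrow> real) \<Rightarrow> real" where
  "pmax E p = (if E = {} then 0 else Max ((\<lambda>(i, t). p i t) ` E))"

definition gfun :: "real \<Rightarrow> real" where
  "gfun x = exp (x + 1) * integral {x + 1..} (\<lambda>y. exp (- y) / y)"

end

theory Submission
  imports Defs
begin

text \<open>An offer of resource \<open>i\<close> to \<open>t\<close> is simulated by a hidden threshold \<open>B i\<close> with an exponential
  distribution: the offer succeeds when the accumulated hazard \<open>- ln (1 - p i t)\<close> of \<open>i\<close> exceeds
  \<open>B i\<close>. Running the algorithm and the offline policy on the same thresholds reduces the claim to a
  deterministic allocation problem with budgets \<open>B i\<close>, to which a primal-dual argument applies: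
  an offer made at load \<open>l\<close> pays \<open>p i t * r i * g l\<close> to the arrival and the rest to \<open>i\<close>.
  Fix the thresholds other than \<open>B i\<close> and let \<open>L\<close> be the load that \<open>i\<close> would get with an infinite
  budget. If \<open>B i > L\<close>, every arrival \<open>t\<close> adjacent to \<open>i\<close> is paid at least \<open>p i t * r i * g L\<close>,
  and the offline policy uses at most \<open>B i\<close> units of \<open>i\<close>. In the limit of vanishing probabilities,
  averaging over \<open>B i\<close> leaves the condition
  \<open>(1 + L) exp (-L) g L + (LINT x=0..L. exp (-x) (1 - g x)) \<ge> g 0\<close>, and \<open>g\<close> is the solution of
  the differential equation \<open>g' = g - 1/(1+x)\<close> that makes it an equality.\<close>

section \<open>The scaling function\<close>

lemma exp_div_integrable:
  fixes a :: real
  assumes "a > 0"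
  shows "(\<lambda>y. exp (- y) / y) integrable_on {a..}"
proof (rule measurable_bounded_by_integrable_imp_integrable)
  show "(\<lambda>y. exp (- y) / y) \<in> borel_measurable (lebesgue_on {a..})"
    using assms by (intro continuous_imp_measurable_on_sets_lebesgue continuous_intros) auto
  show "(\<lambda>y. exp (- 1 * y) * (1 / a)) integrable_on {a..}"
    using has_integral_exp_minus_to_infinity[of 1 a]
    by (intro integrable_on_mult_left) (auto simp: has_integral_integrable_integral)
  show "norm (exp (- y) / y) \<le> exp (- 1 * y) * (1 / a)" if "y \<in> {a..}" for y
    using that assms by (simp add: divide_simps mult_left_mono)
qed auto

lemma exp_div_integral_split:
  fixes a b :: real
  assumes "0 < a" "a \<le> b"
  shows "integral {b..} (\<lambda>y. exp (- y) / y)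
    = integral {a..} (\<lambda>y. exp (- y) / y) - integral {a..b} (\<lambda>y. exp (- y) / y)"
proof -
  let ?f = "\<lambda>y::real. exp (- y) / y"
  have "?f integrable_on {a..b}"
    using assms by (intro integrable_continuous_real continuous_intros) auto
  moreover have "?f integrable_on {b..}"
    using exp_div_integrable[of b] assms by simp
  moreover have "{a..b} \<inter> {b..} = {b}" "{a..b} \<union> {b..} = {a..}" using assms by auto
  ultimately have "(?f has_integral (integral {a..b} ?f + integral {b..} ?f)) {a..}"
    using has_integral_Un[of ?f "integral {a..b} ?f" "{a..b}" "integral {b..} ?f" "{b..}"]
    by (simp add: has_integral_integral)
  then show ?thesis by (simp add: integral_unique)
qed

lemma exp_div_integral_bounds:
  fixes a :: real
  assumes "a > 0"
  shows "0 \<le> integral {a..} (\<lambda>y. exp (- y) / y)"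
    and "integral {a..} (\<lambda>y. exp (- y) / y) \<le> exp (- a) / a"
proof -
  show "0 \<le> integral {a..} (\<lambda>y. exp (- y) / y)"
    using assms by (intro integral_nonneg exp_div_integrable) auto
  have "((\<lambda>y. exp (- 1 * y) * (1 / a)) has_integral (exp (- 1 * a) / 1) * (1 / a)) {a..}"
    by (intro has_integral_mult_left has_integral_exp_minus_to_infinity) auto
  moreover have "exp (- y) / y \<le> exp (- 1 * y) * (1 / a)" if "y \<in> {a..}" for y
    using that assms by (simp add: divide_simps mult_left_mono)
  ultimately show "integral {a..} (\<lambda>y. exp (- y) / y) \<le> exp (- a) / a"
    using has_integral_le[OF integrable_integral[OF exp_div_integrable[OF assms]]] by fastforce
qed

lemma gfun_deriv:
  assumes "x \<ge> 0"
  shows "(gfun has_real_derivative gfun x - 1 / (1 + x)) (at x)"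
proof -
  let ?f = "\<lambda>y::real. exp (- y) / y"
  \<comment> \<open>Rewriting the tail from the fixed base point 1/2 leaves only an integral over a
    bounded interval to differentiate. The rewriting is valid for \<open>z > -1/2\<close>, an open
    neighbourhood of every \<open>x \<ge> 0\<close>.\<close>
  define h where "h = (\<lambda>z. exp (z + 1) * (integral {1/2..} ?f - integral {1/2..z+1} ?f))"
  have "((\<lambda>z. integral {1/2..z} ?f) has_real_derivative ?f (x+1)) (at (x+1) within {1/2..x+2})"
    using assms by (intro integral_has_real_derivative continuous_intros) auto
  moreover have "at (x+1) within {1/2..x+2} = at (x+1)"
    using assms by (intro at_within_interior) auto
  ultimately have "((\<lambda>z. integral {1/2..z} ?f) has_real_derivative ?f (x+1)) (at (x+1))" by simp
  then have "((\<lambda>z. integral {1/2..z+1} ?f) has_real_derivative ?f (x+1)) (at x)"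
    by (simp add: DERIV_shift)
  then have "(h has_real_derivative
      exp (x + 1) * (integral {1/2..} ?f - integral {1/2..x+1} ?f) + exp (x+1) * (0 - ?f (x+1))) (at x)"
    unfolding h_def by (auto intro!: derivative_eq_intros)
  also have "exp (x + 1) * (integral {1/2..} ?f - integral {1/2..x+1} ?f) + exp (x+1) * (0 - ?f (x+1))
      = gfun x - 1 / (1 + x)"
    using exp_div_integral_split[of "1/2" "x+1"] exp_minus_inverse[of "x+1"] assms
    by (simp add: gfun_def add.commute)
  finally show ?thesis
  proof (rule has_field_derivative_transform_within_open[of _ _ _ "{-1/2<..}"])
    show "h z = gfun z" if "z \<in> {-1/2<..}" for z
      using exp_div_integral_split[of "1/2" "z+1"] that by (simp add: gfun_def h_def)
  qed (use assms in auto)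
qed

lemma gfun_nonneg: "x \<ge> 0 \<Longrightarrow> 0 \<le> gfun x"
  using exp_div_integral_bounds(1)[of "x+1"] by (simp add: gfun_def)

text \<open>Bounding \<open>1/y\<close> by its value at the left endpoint leaves a plain exponential
  integral. By the differential equation, the claim says that \<open>gfun\<close> has nonpositive
  derivative.\<close>

lemma gfun_le_inverse:
  assumes "x \<ge> 0"
  shows "gfun x \<le> 1 / (1 + x)"
proof -
  have "exp (x+1) * integral {x + 1..} (\<lambda>y. exp (- y) / y) \<le> exp (x+1) * (exp (- (x+1)) / (x+1))"
    using exp_div_integral_bounds(2)[of "x+1"] assms by (intro mult_left_mono) auto
  also have "\<dots> = 1 / (1 + x)" using exp_minus_inverse[of "x+1"] by (simp add: add.commute)
  finally show ?thesis by (simp add: gfun_def)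
qed

lemma gfun_le_1: "x \<ge> 0 \<Longrightarrow> gfun x \<le> 1"
  using gfun_le_inverse[of x] by (smt (verit) divide_le_eq_1)

lemma gfun_antimono:
  assumes "0 \<le> x" "x \<le> y"
  shows "gfun y \<le> gfun x"
  using assms(2)
proof (rule DERIV_nonpos_imp_nonincreasing)
  fix z assume "x \<le> z" "z \<le> y"
  then show "\<exists>d. (gfun has_real_derivative d) (at z) \<and> d \<le> 0"
    using gfun_deriv[of z] gfun_le_inverse[of z] assms by (intro exI[of _ "gfun z - 1/(1+z)"]) auto
qed

text \<open>The derivative \<open>gfun x - 1/(1+x)\<close> is at least -1, because
  \<open>gfun\<close> is nonnegative. This Lipschitz bound later controls evaluating
  \<open>gfun\<close> at a load instead of a hazard.\<close>

lemma gfun_diff_le: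
  assumes "0 \<le> x" "x \<le> y"
  shows "gfun x - gfun y \<le> y - x"
proof -
  have "gfun x + x \<le> gfun y + y"
    using assms(2)
  proof (rule DERIV_nonneg_imp_nondecreasing)
    fix z assume z: "x \<le> z" "z \<le> y"
    have "((\<lambda>z. gfun z + z) has_real_derivative (gfun z - 1/(1+z)) + 1) (at z)"
      using z assms by (intro derivative_intros gfun_deriv) auto
    moreover have "(gfun z - 1/(1+z)) + 1 \<ge> 0"
      using gfun_nonneg[of z] z assms by (simp add: field_simps)
    ultimately show "\<exists>d. ((\<lambda>z. gfun z + z) has_real_derivative d) (at z) \<and> 0 \<le> d" by blast
  qed
  then show ?thesis by simp
qed

text \<open>Comparison principle for the linear equation \<open>g' = g - 1/(1+x)\<close>, whose only bounded
  solution is \<open>g\<close>: the difference, multiplied by \<open>exp (-x)\<close>, is monotone and vanishes at infinity.\<close>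

lemma nonneg_if_exp_scaled_decreasing:
  fixes f :: "real \<Rightarrow> real"
  assumes deriv: "\<And>x. x \<ge> 0 \<Longrightarrow> (f has_real_derivative f' x) (at x)"
    and le: "\<And>x. x \<ge> 0 \<Longrightarrow> f' x \<le> f x"
    and bound: "\<And>x. x \<ge> 0 \<Longrightarrow> \<bar>f x\<bar> \<le> K"
    and "a \<ge> 0"
  shows "f a \<ge> 0"
proof -
  have mono: "exp (-x) * f x \<le> exp (-a) * f a" if "a \<le> x" for x
    using that
  proof (rule DERIV_nonpos_imp_nonincreasing)
    fix z assume z: "a \<le> z" "z \<le> x"
    have "((\<lambda>z. exp (-z) * f z) has_real_derivative - exp (-z) * f z + f' z * exp (-z)) (at z)"
      using z assms(4) by (auto intro!: derivative_eq_intros deriv)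
    moreover have "- exp (-z) * f z + f' z * exp (-z) \<le> 0"
      using le[of z] z assms(4) by (simp add: mult.commute)
    ultimately show "\<exists>d. ((\<lambda>z. exp (-z) * f z) has_real_derivative d) (at z) \<and> d \<le> 0" by blast
  qed
  have "((\<lambda>x::real. exp (-x) * K) \<longlongrightarrow> 0 * K) at_top"
    by (intro tendsto_intros filterlim_compose[OF exp_at_bot filterlim_uminus_at_bot_at_top])
  then have "((\<lambda>x::real. exp (-x) * K) \<longlongrightarrow> 0) at_top" by simp
  moreover have "\<forall>\<^sub>F x in at_top. norm (exp (-x) * f x) \<le> exp (-x) * K"
    using eventually_ge_at_top[of 0] by eventually_elim (auto simp: abs_mult bound)
  ultimately have "((\<lambda>x. exp (-x) * f x) \<longlongrightarrow> 0) at_top"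
    by (rule Lim_null_comparison[rotated])
  moreover have "\<forall>\<^sub>F x in at_top. exp (-x) * f x \<le> exp (-a) * f a"
    using eventually_ge_at_top[of a] by eventually_elim (rule mono)
  ultimately have "0 \<le> exp (-a) * f a"
    by (intro tendsto_upperbound[of "\<lambda>x. exp (-x) * f x" 0 at_top]) auto
  then show ?thesis by (simp add: zero_le_mult_iff)
qed

section \<open>Rational bounds for \<open>gfun\<close>\<close>

text \<open>The rational function leaves the nonnegative residual
  \<open>2 / ((x+1) * (x+3))^2\<close> in the equation \<open>g' = g - 1/(1+x)\<close>, so it is a
  bounded supersolution and the comparison principle applies.\<close>

lemma gfun_upper:
  assumes "x \<ge> 0"
  shows "gfun x \<le> (x + 2) / ((x + 1) * (x + 3))"
proof -
  let ?R = "\<lambda>x::real. (x + 2) / ((x + 1) * (x + 3))"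
  let ?R' = "\<lambda>x::real. (((x+1)*(x+3)) - (x+2) * (2*x+4)) / ((x + 1) * (x + 3))^2"
  have "?R x - gfun x \<ge> 0"
  proof (rule nonneg_if_exp_scaled_decreasing[where K = 2 and a = x and f = "\<lambda>x. ?R x - gfun x"
        and f' = "\<lambda>x. ?R' x - (gfun x - 1/(1+x))"])
    fix z :: real assume z: "z \<ge> 0"
    have "(?R has_real_derivative ?R' z) (at z)"
      using z no_zero_divisors[of "z+1" "z+3"]
      by (auto intro!: derivative_eq_intros simp: power2_eq_square)
    then show "((\<lambda>x. ?R x - gfun x) has_real_derivative ?R' z - (gfun z - 1/(1+z))) (at z)"
      by (intro derivative_intros gfun_deriv z)
    have "?R z - ?R' z - 1/(1+z) = 2 / ((z + 1) * (z + 3))^2"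
      using z by (simp add: divide_simps) (simp add: algebra_simps power2_eq_square)
    moreover have "2 / ((z + 1) * (z + 3))^2 \<ge> 0" by simp
    ultimately show "?R' z - (gfun z - 1/(1+z)) \<le> ?R z - gfun z" by linarith
    have "?R z \<ge> 0" "?R z \<le> 1" using z mult_nonneg_nonneg[OF z z]
      by (auto intro!: divide_nonneg_nonneg simp: divide_le_eq_1 algebra_simps)
    then show "\<bar>?R z - gfun z\<bar> \<le> 2" using gfun_nonneg[OF z] gfun_le_1[OF z] by linarith
  qed (use assms in auto)
  then show ?thesis by simp
qed

text \<open>The rational function is the seventh convergent of the continued fraction
  \<open>1/(y+1 - 1/(y+3 - 4/(y+5 - 9/(y+7 - \<dots>))))\<close> of \<open>gfun (y - 1)\<close>.\<close>

lemma gfun_0_gt: "gfun 0 > 0.596"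
proof -
  define N :: "real \<Rightarrow> real" where
    "N = (\<lambda>y. 13068 + 33984*y + 23544*y^2 + 6560*y^3 + 835*y^4 + 48*y^5 + y^6)"
  define D :: "real \<Rightarrow> real" where
    "D = (\<lambda>y. 5040 + 35280*y + 52920*y^2 + 29400*y^3 + 7350*y^4 + 882*y^5 + 49*y^6 + y^7)"
  define N' :: "real \<Rightarrow> real" where
    "N' = (\<lambda>y. 33984 + 47088*y + 19680*y^2 + 3340*y^3 + 240*y^4 + 6*y^5)"
  define D' :: "real \<Rightarrow> real" where
    "D' = (\<lambda>y. 35280 + 105840*y + 88200*y^2 + 29400*y^3 + 4410*y^4 + 294*y^5 + 7*y^6)"
  have pos: "D y > 0" if "y \<ge> 0" for y using that unfolding D_def by (simp add: add_pos_nonneg)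
  have frac: "1/y + a/(d*d) - b/d = (d*d + y*a - y*b*d) / (y*(d*d))" if "y \<noteq> 0" "d \<noteq> 0"
    for y d a b :: real using that by (simp add: field_simps)
  have "gfun 0 - N (0+1) / D (0+1) \<ge> 0"
  proof (rule nonneg_if_exp_scaled_decreasing[where K = 4 and a = 0 and f = "\<lambda>x. gfun x - N (x+1) / D (x+1)" and
        f' = "\<lambda>x. (gfun x - 1/(1+x)) - (N' (x+1) * D (x+1) - N (x+1) * D' (x+1)) / (D (x+1) * D (x+1))"])
    fix z :: real assume z: "z \<ge> 0"
    have "((\<lambda>x. N (x+1)) has_real_derivative N' (z+1)) (at z)"
      unfolding N_def N'_def by (auto intro!: derivative_eq_intros)
    moreover have "((\<lambda>x. D (x+1)) has_real_derivative D' (z+1)) (at z)"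
      unfolding D_def D'_def by (auto intro!: derivative_eq_intros)
    ultimately show "((\<lambda>x. gfun x - N (x+1) / D (x+1)) has_real_derivative
       (gfun z - 1/(1+z)) - (N' (z+1) * D (z+1) - N (z+1) * D' (z+1)) / (D (z+1) * D (z+1))) (at z)"
      using pos[of "z+1"] z by (intro derivative_intros gfun_deriv) auto
    \<comment> \<open>The constant is \<open>(7!)^2\<close>: the residual of \<open>N / D\<close> in
      the differential equation collapses to \<open>(7!)^2 / (y * D^2)\<close>, whose sign makes
      \<open>N / D\<close> a subsolution.\<close>
    have id: "D y * D y + y * (N' y * D y - N y * D' y) - y * N y * D y = 25401600" for y
      unfolding D_def N_def N'_def D'_def by (simp add: algebra_simps eval_nat_numeral)
    have nn: "D (z+1) * D (z+1) + (z+1) * (N' (z+1) * D (z+1) - N (z+1) * D' (z+1))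
       - (z+1) * N (z+1) * D (z+1) \<ge> 0" using id[of "z+1"] by linarith
    have "1/(1+z) + (N' (z+1) * D (z+1) - N (z+1) * D' (z+1)) / (D (z+1) * D (z+1)) - N (z+1) / D (z+1)
      = (D (z+1) * D (z+1) + (z+1) * (N' (z+1) * D (z+1) - N (z+1) * D' (z+1))
       - (z+1) * N (z+1) * D (z+1)) / ((z+1) * (D (z+1) * D (z+1)))"
      using frac[of "z+1" "D (z+1)" "N' (z+1) * D (z+1) - N (z+1) * D' (z+1)" "N (z+1)"]
        pos[of "z+1"] z by (simp add: add.commute)
    also have "\<dots> \<ge> 0" using nn pos[of "z+1"] z by (intro divide_nonneg_nonneg) auto
    finally show "(gfun z - 1/(1+z)) - (N' (z+1) * D (z+1) - N (z+1) * D' (z+1)) / (D (z+1) * D (z+1))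
      \<le> gfun z - N (z+1) / D (z+1)" by linarith
    have "N (z+1) \<ge> 0" using z unfolding N_def by simp
    moreover have "N (z+1) \<le> 3 * D (z+1)"
    proof -
      have "0 \<le> z+1" using z by simp
      then have "(z+1)^k \<ge> 0" for k by simp
      then show ?thesis unfolding N_def D_def
        using \<open>0 \<le> z+1\<close> by (smt (verit))
    qed
    ultimately have "0 \<le> N (z+1) / D (z+1)" "N (z+1) / D (z+1) \<le> 3"
      using pos[of "z+1"] z by (auto simp: divide_simps)
    then show "\<bar>gfun z - N (z+1) / D (z+1)\<bar> \<le> 4" 
      using gfun_nonneg[OF z] gfun_le_1[OF z] by linarith
  qed auto
  moreover have "N (0+1) / D (0+1) > 0.596" unfolding N_def D_def by simp
  ultimately show ?thesis by linarith
qed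

text \<open>The potential \<open>(1+x) exp(-x) g(x)\<close> has derivative \<open>- exp(-x) (1 - g(x))\<close>.\<close>

lemma gfun_potential_diff:
  assumes "0 \<le> c" "c \<le> d"
  shows "(1 + c) * exp (-c) * gfun c - (1 + d) * exp (-d) * gfun d
    \<le> (1 - gfun d) * (exp (-c) - exp (-d))"
proof -
  \<comment> \<open>Subtracting \<open>(1 - gfun d) * exp (-x)\<close> turns the derivative into
    \<open>exp (-z) * (gfun z - gfun d)\<close>, which is nonnegative up to \<open>d\<close> by
    monotonicity.\<close>
  let ?F = "\<lambda>x. (1 + x) * exp (-x) * gfun x - (1 - gfun d) * exp (-x)"
  have "?F c \<le> ?F d"
    using assms(2)
  proof (rule DERIV_nonneg_imp_nondecreasing)
    fix z assume z: "c \<le> z" "z \<le> d"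
    have "(?F has_real_derivative
        (exp (-z) - (1 + z) * exp (-z)) * gfun z + (1 + z) * exp (-z) * (gfun z - 1/(1+z))
        + (1 - gfun d) * exp (-z)) (at z)"
      using z assms by (auto intro!: derivative_eq_intros gfun_deriv simp: algebra_simps)
    moreover have "(exp (-z) - (1 + z) * exp (-z)) * gfun z + (1 + z) * exp (-z) * (gfun z - 1/(1+z))
        + (1 - gfun d) * exp (-z) = exp (-z) * (gfun z - gfun d)"
      using z assms by (simp add: divide_simps) (simp add: algebra_simps)
    moreover have "exp (-z) * (gfun z - gfun d) \<ge> 0"
      using gfun_antimono[of z d] z assms by simp
    ultimately show "\<exists>e. (?F has_real_derivative e) (at z) \<and> 0 \<le> e" by metis
  qed
  then show ?thesis by (simp add: algebra_simps)
qed

section \<open>Discretised exponential thresholds\<close>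

text \<open>Rounding an exponential variable down to \<open>S\<close> gives each point the mass of
  the interval up to its successor, and the largest point the whole remaining tail. Tail masses at
  points of \<open>S\<close> are exact, and rounding down can only lower the partial first moments,
  whose continuous values come from the antiderivative \<open>-(1+x) * exp (-x)\<close>. The
  induction adds points from the right to the left, hence the general \<open>Min S\<close>.\<close>

lemma exponential_weights:
  fixes S :: "real set"
  assumes "finite S" "S \<noteq> {}"
  shows "\<exists>w. (\<forall>x. 0 \<le> w x)
     \<and> (\<forall>c\<in>S. (\<Sum>x\<in>{x\<in>S. c \<le> x}. w x) = exp (-c))
     \<and> (\<forall>c\<in>S. (\<Sum>x\<in>{x\<in>S. c \<le> x}. w x * x) \<le> (1 + c) * exp (-c))
     \<and> (\<forall>c\<in>S. (\<Sum>x\<in>{x\<in>S. x < c}. w x * x) \<le> (1 + Min S) * exp (-Min S) - (1 + c) * exp (-c))"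
  using assms
proof (induction S rule: finite_linorder_min_induct)
  case empty
  then show ?case by simp
next
  case (insert b A)
  show ?case
  proof (cases "A = {}")
    case True
    have "{x. x = b \<and> b \<le> x} = {b}" by auto
    moreover have "(\<Sum>x | x = b \<and> x < b. f x) = 0" for f :: "real \<Rightarrow> real"
      by (rule sum.neutral) auto
    ultimately show ?thesis using True
      by (intro exI[of _ "\<lambda>_. exp (-b)"]) (auto simp: algebra_simps)
  next
    case False
    define d where "d = Min A"
    have d: "d \<in> A" "b < d" "\<And>x. x \<in> A \<Longrightarrow> d \<le> x" "Min (insert b A) = b"
      using False insert.hyps unfolding d_def by (auto simp: Min_insert2 less_imp_le)
    obtain w where w: "\<And>x. 0 \<le> w x"
      and w1: "\<And>c. c \<in> A \<Longrightarrow> (\<Sum>x\<in>{x\<in>A. c \<le> x}. w x) = exp (-c)"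
      and w2: "\<And>c. c \<in> A \<Longrightarrow> (\<Sum>x\<in>{x\<in>A. c \<le> x}. w x * x) \<le> (1 + c) * exp (-c)"
      and w3: "\<And>c. c \<in> A \<Longrightarrow>
        (\<Sum>x\<in>{x\<in>A. x < c}. w x * x) \<le> (1 + d) * exp (-d) - (1 + c) * exp (-c)"
      using insert.IH[OF False] unfolding d_def by blast
    \<comment> \<open>The new smallest point \<open>b\<close> takes the exponential mass between
      \<open>b\<close> and the next point \<open>d\<close>.\<close>
    define v where "v = w(b := exp (-b) - exp (-d))"
    have bA: "b \<notin> A" using insert.hyps by auto
    have vA: "v x = w x" if "x \<in> A" for x using bA that by (auto simp: v_def)
    have all: "{x\<in>insert b A. b \<le> x} = insert b {x\<in>A. d \<le> x}" using insert.hyps d by force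
    have up: "{x\<in>insert b A. c \<le> x} = {x\<in>A. c \<le> x}" if "c \<in> A" for c using insert.hyps that by force
    have low: "{x\<in>insert b A. x < c} = insert b {x\<in>A. x < c}" if "c \<in> A" for c
      using insert.hyps that by force
    have lowb: "{x\<in>insert b A. x < b} = {}" using insert.hyps by force
    \<comment> \<open>This yields \<open>step\<close>: the moment of the new mass placed at
      \<open>b\<close> is at most the integral of \<open>x * exp (-x)\<close> from \<open>b\<close>
      to \<open>d\<close>.\<close>
    have "1 + (d - b) \<le> exp (d - b)" by (rule exp_ge_add_one_self)
    then have "exp (-d) * (1 + (d - b)) \<le> exp (-d) * exp (d - b)" by (intro mult_left_mono) auto
    then have step: "(exp (-b) - exp (-d)) * b \<le> (1 + b) * exp (-b) - (1 + d) * exp (-d)"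
      by (simp add: exp_add[symmetric] algebra_simps)
    show ?thesis
    proof (intro exI[of _ v] conjI allI ballI)
      show "0 \<le> v x" for x using w d by (auto simp: v_def)
      fix c assume c: "c \<in> insert b A"
      show "(\<Sum>x\<in>{x\<in>insert b A. c \<le> x}. v x) = exp (-c)"
      proof (cases "c = b")
        case True
        have "(\<Sum>x\<in>{x\<in>A. d \<le> x}. v x) = exp (-d)" using w1[OF d(1)] by (simp add: vA)
        then show ?thesis unfolding True all using bA insert.hyps by (simp add: v_def)
      next
        case False
        then have cA: "c \<in> A" using c by simp
        then show ?thesis unfolding up[OF cA] using w1[OF cA] by (simp add: vA)
      qed
      show "(\<Sum>x\<in>{x\<in>insert b A. c \<le> x}. v x * x) \<le> (1 + c) * exp (-c)"
      proof (cases "c = b")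
        case True
        have "(\<Sum>x\<in>{x\<in>A. d \<le> x}. v x * x) \<le> (1 + d) * exp (-d)" using w2[OF d(1)] by (simp add: vA)
        then show ?thesis unfolding True all using bA insert.hyps step by (simp add: v_def)
      next
        case False
        then have cA: "c \<in> A" using c by simp
        then show ?thesis unfolding up[OF cA] using w2[OF cA] by (simp add: vA)
      qed
      show "(\<Sum>x\<in>{x\<in>insert b A. x < c}. v x * x)
          \<le> (1 + Min (insert b A)) * exp (- Min (insert b A)) - (1 + c) * exp (-c)"
      proof (cases "c = b")
        case False
        then have cA: "c \<in> A" using c by auto
        have "(\<Sum>x\<in>{x\<in>A. x < c}. v x * x) \<le> (1 + d) * exp (-d) - (1 + c) * exp (-c)"
          using w3[OF cA] by (simp add: vA)
        then show ?thesis unfolding low[OF cA] d(4) using bA insert.hyps step by (simp add: v_def)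
      qed (simp only: lowb d(4), simp)
    qed
  qed
qed

section \<open>The potential and the inequality for a single resource\<close>

text \<open>An offer with probability \<open>a\<close> raises the hazard \<open>H\<close> by
  \<open>- ln (1 - a)\<close>; it takes place with probability \<open>exp (-H)\<close> and leaves
  the share \<open>1 - gfun A\<close> to the resource, where \<open>A\<close> is the load. The main
  part of \<open>U\<close> is the continuous potential. Its correction pays for reading
  \<open>gfun\<close> at \<open>A\<close> rather than at the new hazard, since
  \<open>-(2+x) * exp (-x)\<close> has derivative \<open>(1+x) * exp (-x)\<close>, matching the
  error \<open>2 * \<delta> * (1 + H)\<close>. The second, cruder potential has no error
  term.\<close>

lemma gfun_step:
  assumes "0 \<le> a" "a \<le> \<delta>" "\<delta> \<le> 1/4" "0 \<le> A" "A \<le> H" "H \<le> (1 + 2 * \<delta>) * A"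
  defines "U \<equiv> \<lambda>x. (1 + x) * exp (-x) * gfun x - 2 * \<delta> * ((2 + x) * exp (-x))"
  shows "U H - U (H - ln (1 - a)) \<le> a * (1 - gfun A) * exp (-H)"
    and "(1 - gfun 0) * exp (-H) - (1 - gfun 0) * exp (- (H - ln (1 - a))) \<le> a * (1 - gfun A) * exp (-H)"
proof -
  define q where "q = - ln (1 - a)"
  have expq: "exp (- (H + q)) = (1 - a) * exp (-H)"
    using assms by (simp add: q_def exp_add exp_diff exp_minus field_simps)
  have "ln (1 / (1 - a)) \<le> 1 / (1 - a) - 1" using assms by (intro ln_le_minus_one) auto
  then have "q \<le> a / (1 - a)" using assms by (simp add: q_def ln_div field_simps)
  then have q1: "q * (1 - a) \<le> a" using assms by (simp add: field_simps)
  have q0: "q \<ge> 0" using assms by (simp add: q_def)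
  have "q * (3/4) \<le> q * (1 - a)" using q0 assms by (intro mult_left_mono) auto
  then have q2: "q \<le> 2 * \<delta>" using q1 assms by linarith
  have diff: "exp (-H) - exp (- (H + q)) = a * exp (-H)" unfolding expq by (simp add: algebra_simps)
  have "2 * \<delta> * A \<le> 2 * \<delta> * H" using assms by (intro mult_left_mono) auto
  then have "H + q - A \<le> 2 * \<delta> * (1 + H)" using assms q2 by (simp add: algebra_simps)
  then have "gfun A - gfun (H + q) \<le> 2 * \<delta> * (1 + H)" 
    using gfun_diff_le[of A "H+q"] assms q0 by linarith
  then have "(gfun A - gfun (H + q)) * (a * exp (-H)) \<le> 2 * \<delta> * (1 + H) * (a * exp (-H))"
    using assms by (intro mult_right_mono) auto
  also have "\<dots> \<le> 2 * \<delta> * ((2 + H) * exp (-H) - (2 + (H + q)) * exp (- (H + q)))"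
  proof -
    \<comment> \<open>The right-hand side is the exact drop of \<open>(2+x) * exp (-x)\<close> over
      the step; the inequality is \<open>q * (1 - a) \<le> a\<close>.\<close>
    have "exp (-H) * (a * (1 + H)) \<le> exp (-H) * (a * (2 + H) - q * (1 - a))"
      using q1 by (intro mult_left_mono) (auto simp: algebra_simps)
    then have "(1 + H) * (a * exp (-H)) \<le> (2 + H) * exp (-H) - (2 + (H + q)) * exp (- (H + q))"
      unfolding expq by (simp add: algebra_simps)
    then have "2 * \<delta> * ((1 + H) * (a * exp (-H)))
      \<le> 2 * \<delta> * ((2 + H) * exp (-H) - (2 + (H + q)) * exp (- (H + q)))"
      using assms by (intro mult_left_mono) auto
    then show ?thesis by (simp only: mult.assoc)
  qed
  finally have err: "(gfun A - gfun (H + q)) * (a * exp (-H))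
    \<le> 2 * \<delta> * ((2 + H) * exp (-H) - (2 + (H + q)) * exp (- (H + q)))" .
  have "(1 + H) * exp (-H) * gfun H - (1 + (H + q)) * exp (-(H + q)) * gfun (H + q)
     \<le> (1 - gfun (H + q)) * (a * exp (-H))"
    using gfun_potential_diff[of H "H+q"] assms q0 unfolding diff by simp
  then have "U H - U (H + q) \<le> (1 - gfun (H + q)) * (a * exp (-H))
     - 2 * \<delta> * ((2 + H) * exp (-H) - (2 + (H + q)) * exp (- (H + q)))"
    unfolding U_def right_diff_distrib by linarith
  also have "\<dots> \<le> (1 - gfun (H + q)) * (a * exp (-H)) - (gfun A - gfun (H + q)) * (a * exp (-H))"
    using err by linarith
  also have "\<dots> = a * (1 - gfun A) * exp (-H)" by (simp add: algebra_simps)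
  finally show "U H - U (H - ln (1 - a)) \<le> a * (1 - gfun A) * exp (-H)" by (simp add: q_def)
  have "(1 - gfun 0) * (a * exp (-H)) \<le> (1 - gfun A) * (a * exp (-H))"
    using gfun_antimono[of 0 A] assms by (intro mult_right_mono) auto
  then have "(1 - gfun 0) * (exp (-H) - exp (- (H + q))) \<le> a * (1 - gfun A) * exp (-H)"
    unfolding diff by (simp add: algebra_simps)
  then show "(1 - gfun 0) * exp (-H) - (1 - gfun 0) * exp (- (H - ln (1 - a)))
      \<le> a * (1 - gfun A) * exp (-H)" by (simp add: q_def right_diff_distrib)
qed

lemma gfun_quarter_le: "gfun (1/4) \<le> 0.56"
  using gfun_upper[of "1/4"] by (simp add: field_simps)

lemma gfun_0_le: "gfun 0 \<le> 2/3"
  using gfun_upper[of 0] by simp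

text \<open>Averages the primal-dual argument over the threshold \<open>x\<close> of one resource,
  per unit reward: \<open>Y x\<close> is the offline use, \<open>\<theta>\<close> the resource's
  dual, and \<open>Q\<close> and \<open>L\<close> are its hazard and load under an inexhaustible
  budget. Prices of at least \<open>gfun L\<close> per unit are guaranteed only for
  \<open>x \<ge> Q\<close>.\<close>

lemma single_resource_bound:
  fixes S :: "real set" and w Y :: "real \<Rightarrow> real"
  assumes S: "finite S" "0 \<in> S" "\<And>x. x \<in> S \<Longrightarrow> 0 \<le> x"
    and w: "\<And>x. 0 \<le> w x"
    and w1: "\<And>c. c \<in> S \<Longrightarrow> (\<Sum>x\<in>{x\<in>S. c \<le> x}. w x) = exp (-c)"
    and w2: "\<And>c. c \<in> S \<Longrightarrow> (\<Sum>x\<in>{x\<in>S. c \<le> x}. w x * x) \<le> (1 + c) * exp (-c)"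
    and w3: "\<And>c. c \<in> S \<Longrightarrow> (\<Sum>x\<in>{x\<in>S. x < c}. w x * x) \<le> 1 - (1 + c) * exp (-c)"
    and \<delta>: "0 \<le> \<delta>" "\<delta> \<le> 1/200"
    and Q: "Q \<in> S" "0 \<le> L" "L \<le> Q" "Q \<le> (1 + 2 * \<delta>) * L"
    and Y: "\<And>x. x \<in> S \<Longrightarrow> 0 \<le> Y x" "\<And>x. x \<in> S \<Longrightarrow> Y x \<le> x + \<delta>"
    and \<theta>1: "gfun 0 - (1 + Q) * exp (-Q) * gfun Q - 4 * \<delta> \<le> \<theta>"
    and \<theta>2: "(1 - gfun 0) * (1 - exp (-Q)) \<le> \<theta>"
  shows "gfun 0 * (1 - 9 * \<delta>) * (\<Sum>x\<in>S. w x * Y x)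
     \<le> \<theta> + gfun L * (\<Sum>x\<in>{x\<in>S. Q \<le> x}. w x * Y x)"
proof -
  define \<beta> where "\<beta> = gfun 0 * (1 - 9 * \<delta>)"
  define lo where "lo = (\<Sum>x\<in>{x\<in>S. x < Q}. w x * Y x)"
  define hi where "hi = (\<Sum>x\<in>{x\<in>S. Q \<le> x}. w x * Y x)"
  have split: "(\<Sum>x\<in>S. w x * f x)
      = (\<Sum>x\<in>{x\<in>S. x < Q}. w x * f x) + (\<Sum>x\<in>{x\<in>S. Q \<le> x}. w x * f x)" for f :: "real \<Rightarrow> real"
  proof -
    have "S = {x\<in>S. x < Q} \<union> {x\<in>S. Q \<le> x}" by auto
    then have "(\<Sum>x\<in>S. w x * f x) = (\<Sum>x\<in>{x\<in>S. x < Q} \<union> {x\<in>S. Q \<le> x}. w x * f x)" by metis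
    also have "\<dots> = (\<Sum>x\<in>{x\<in>S. x < Q}. w x * f x) + (\<Sum>x\<in>{x\<in>S. Q \<le> x}. w x * f x)"
      using S(1) by (intro sum.union_disjoint) auto
    finally show ?thesis .
  qed
  have "{x\<in>S. 0 \<le> x} = S" using S by auto
  then have "(\<Sum>x\<in>S. w x) = 1" using w1[OF S(2)] by simp
  then have wlo: "(\<Sum>x\<in>{x\<in>S. x < Q}. w x) = 1 - exp (-Q)"
    using split[of "\<lambda>_. 1"] w1[OF Q(1)] by simp
  have le: "(\<Sum>x\<in>X. w x * Y x) \<le> (\<Sum>x\<in>X. w x * x) + \<delta> * (\<Sum>x\<in>X. w x)" if "X \<subseteq> S" for X
    unfolding sum_distrib_left sum.distrib[symmetric]
  proof (rule sum_mono)
    fix x assume "x \<in> X"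
    then have "w x * Y x \<le> w x * (x + \<delta>)" using that Y w by (intro mult_left_mono) auto
    then show "w x * Y x \<le> w x * x + \<delta> * w x" by (simp add: algebra_simps)
  qed
  have lo1: "lo \<le> 1 - (1 + Q) * exp (-Q) + \<delta> * (1 - exp (-Q))"
    unfolding lo_def using le[of "{x\<in>S. x < Q}"] w3[OF Q(1)] by (simp add: wlo)
  have hi1: "hi \<le> (1 + Q) * exp (-Q) + \<delta> * exp (-Q)"
    unfolding hi_def using le[of "{x\<in>S. Q \<le> x}"] w2[OF Q(1)] by (simp add: w1[OF Q(1)])
  have hi0: "hi \<ge> 0" unfolding hi_def using Y w by (intro sum_nonneg) auto
  have \<alpha>: "gfun 0 > 0.596" "gfun 0 \<le> 2/3" by (rule gfun_0_gt gfun_0_le)+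
  have \<beta>0: "0 \<le> \<beta>" "\<beta> \<le> gfun 0" using \<alpha> \<delta> unfolding \<beta>_def by (auto simp: mult_le_cancel_left1)
  have Q0: "0 \<le> Q" "exp (-Q) \<le> 1" using Q by auto
  have gQ: "gfun Q \<le> gfun L" "0 \<le> gfun L" using gfun_antimono[of L Q] gfun_nonneg Q by auto
  have "\<beta> * (lo + hi) \<le> \<theta> + gfun L * hi"
  proof (cases "gfun L \<le> \<beta>")
    case True
    \<comment> \<open>Both \<open>\<beta>\<close> and \<open>\<beta> - gfun L\<close> are
      nonnegative here, so the upper bounds on \<open>lo\<close> and \<open>hi\<close> may be
      inserted; the terms \<open>\<beta> * P\<close> then cancel.\<close>
    define P where "P = (1 + Q) * exp (-Q)"
    have "\<beta> * lo + (\<beta> - gfun L) * hi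
      \<le> \<beta> * (1 - P + \<delta> * (1 - exp (-Q))) + (\<beta> - gfun L) * (P + \<delta> * exp (-Q))"
      using True \<beta>0 lo1 hi1 unfolding P_def by (intro add_mono mult_left_mono) auto
    also have "\<dots> = \<beta> * (1 + \<delta>) - gfun L * P - gfun L * (\<delta> * exp (-Q))"
      by (simp add: algebra_simps)
    also have "\<dots> \<le> \<beta> * (1 + \<delta>) - gfun L * P"
      using gQ \<delta> by simp
    also have "\<dots> \<le> gfun 0 - 4 * \<delta> - gfun L * P"
    proof -
      \<comment> \<open>The loss 9 covers one \<open>\<delta>\<close> of overshoot, and the other
        eight, multiplied by \<open>gfun 0 \<ge> 1/2\<close>, cover the \<open>4 * \<delta>\<close>
        in the bound on \<open>\<theta>\<close>.\<close>
      have "gfun 0 * ((1 - 9 * \<delta>) * (1 + \<delta>)) \<le> gfun 0 * (1 - 8 * \<delta>)"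
        using \<alpha> \<delta> by (intro mult_left_mono) (auto simp: algebra_simps)
      also have "\<dots> \<le> gfun 0 - 4 * \<delta>"
        using mult_right_mono[of "0.5" "gfun 0" "8 * \<delta>"] \<alpha> \<delta> by (simp add: algebra_simps)
      finally show ?thesis unfolding \<beta>_def by simp
    qed
    also have "\<dots> \<le> gfun 0 - 4 * \<delta> - gfun Q * P"
      using gQ Q0 unfolding P_def by (simp add: mult_right_mono)
    also have "\<dots> \<le> \<theta>" using \<theta>1 unfolding P_def by (simp add: mult.commute)
    finally show ?thesis by (simp add: algebra_simps)
  next
    case False
    \<comment> \<open>Now the prices alone pay for \<open>hi\<close>, and \<open>\<theta>\<close>
      has to cover only \<open>\<beta> * lo\<close>. A large \<open>gfun L\<close> forces
      \<open>L < 1/4\<close>, so thresholds below \<open>Q\<close> are small and the cruder bound on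
      \<open>\<theta>\<close> suffices.\<close>
    have "gfun 0 * (1 - 9 * \<delta>) \<ge> 0.596 * (1 - 9/200)"
      using \<alpha> \<delta> by (intro mult_mono) auto
    then have "\<beta> > 0.56" unfolding \<beta>_def by simp
    then have "L < 1/4" using False gfun_quarter_le gfun_antimono[of "1/4" L] by linarith
    then have "(1 + 2 * \<delta>) * L \<le> (1 + 1/100) * (1/4)" using \<delta> Q by (intro mult_mono) auto
    with Q(4) have "Q \<le> (1 + 1/100) * (1/4)" by (rule order_trans)
    then have Qs: "Q + \<delta> \<le> 1/2" using \<delta> by simp
    have "lo \<le> (\<Sum>x\<in>{x\<in>S. x < Q}. w x * (Q + \<delta>))"
      unfolding lo_def using Y w by (intro sum_mono mult_left_mono) force+
    also have "\<dots> = (1 - exp (-Q)) * (Q + \<delta>)" by (simp add: wlo sum_distrib_right[symmetric])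
    also have "\<dots> \<le> (1 - exp (-Q)) * (1/2)" using Q0 Qs by (intro mult_left_mono) auto
    finally have "\<beta> * lo \<le> \<beta> * ((1 - exp (-Q)) * (1/2))" using \<beta>0 by (intro mult_left_mono)
    also have "\<dots> \<le> 2/3 * ((1 - exp (-Q)) * (1/2))"
      using \<beta>0 \<alpha> Q0 by (intro mult_right_mono) auto
    also have "\<dots> \<le> (1 - gfun 0) * (1 - exp (-Q))"
      using mult_right_mono[of "1/3" "1 - gfun 0" "1 - exp (-Q)"] \<alpha> Q0 by simp
    also have "\<dots> \<le> \<theta>" by (rule \<theta>2)
    finally have "\<beta> * lo \<le> \<theta>" .
    moreover have "\<beta> * hi \<le> gfun L * hi" using False hi0 by (intro mult_right_mono) auto
    ultimately show ?thesis by (simp add: algebra_simps)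
  qed
  then show ?thesis using split[of Y] by (simp add: \<beta>_def lo_def hi_def)
qed

section \<open>Coupled runs\<close>

text \<open>Failure probabilities multiply, so their negative logarithms add: a resource survives
  its offers with probability \<open>exp\<close> of minus the total hazard. The value 0 off the
  edges allows sums over arbitrary sets of arrivals.\<close>

definition hazard :: "(nat \<times> nat) set \<Rightarrow> (nat \<Rightarrow> nat \<Rightarrow> real) \<Rightarrow> nat \<Rightarrow> nat \<Rightarrow> real" where
  "hazard E p i t = (if (i, t) \<in> E then - ln (1 - p i t) else 0)"

definition offered :: "(nat \<Rightarrow> real) \<Rightarrow> history \<Rightarrow> nat \<Rightarrow> real" where
  "offered f h i = sum_list (map (\<lambda>(t, a, s). if a = Some i then f t else 0) h)"

lemma load_Nil [simp]: "load f [] i = 0"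
  and load_append [simp]: "load f (h @ h') i = load f h i + load f h' i"
  and load_single [simp]: "load f [(t, a, s)] i = (if a = Some i \<and> \<not> s then f i t else 0)"
  by (simp_all add: load_def)

lemma offered_Nil [simp]: "offered f [] i = 0"
  and offered_append [simp]: "offered f (h @ h') i = offered f h i + offered f h' i"
  and offered_Cons [simp]: "offered f ((t, a, s) # h) i = (if a = Some i then f t else 0) + offered f h i"
  by (simp_all add: offered_def)

lemma avail_simps [simp]:
  "avail n [] = {..<n}"
  "avail n (h @ [(t, None, s)]) = avail n h"
  "avail n (h @ [(t, Some i, False)]) = avail n h"
  "avail n (h @ [(t, Some i, True)]) = avail n h - {i}"
  by (auto simp: avail_def)

lemma avail_append_subset: "avail n (h @ h') \<subseteq> avail n h"
  by (auto simp: avail_def)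

lemma processed_simps [simp]:
  "processed [] = {}" "processed (h @ h') = processed h \<union> processed h'"
  "processed [(t, a, s)] = {t}"
  by (auto simp: processed_def)

lemma load_eq_sum:
  "distinct (map fst h) \<Longrightarrow> load f h i = sum (f i) {t. (t, Some i, False) \<in> set h}"
proof (induction h)
  case Nil
  then show ?case by simp
next
  case (Cons e h)
  obtain t a s where e: "e = (t, a, s)" by (cases e)
  have fin: "finite {t. (t, Some i, False) \<in> set h}"
    by (rule finite_subset[of _ "fst ` set h"]) force+
  have nin: "t \<notin> {t. (t, Some i, False) \<in> set h}" using Cons.prems e by force
  have "load f (e # h) i = (if a = Some i \<and> \<not> s then f i t else 0) + load f h i"
    by (simp add: load_def e)
  moreover have "{t. (t, Some i, False) \<in> set (e # h)} =
     (if a = Some i \<and> \<not> s then insert t {t. (t, Some i, False) \<in> set h}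
      else {t. (t, Some i, False) \<in> set h})" by (auto simp: e)
  ultimately show ?case using Cons fin nin by simp
qed

lemma pval_nonneg:
  assumes "\<forall>(i, t)\<in>E. 0 \<le> p i t \<and> p i t \<le> 1" "\<forall>i<n. r i > 0"
  shows "0 \<le> pval n m E p r k pol h"
proof (induction k arbitrary: h)
  case (Suc k)
  show ?case using assms
    by (auto split: prod.splits option.splits simp: Suc avail_def intro!: add_nonneg_nonneg mult_nonneg_nonneg
        dest!: bspec)
qed simp

text \<open>The outcomes of all offers are driven by one hidden threshold \<open>B i\<close> per resource: an offer
  of \<open>i\<close> succeeds when it pushes the accumulated hazard of \<open>i\<close> above \<open>B i\<close>. The thresholds are
  independent, with an exponential distribution rounded down to a finite set \<open>S\<close> that
  contains every hazard that can occur; \<open>w\<close> is its probability mass function. This makes the same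
  \<open>B\<close> usable for two policies that process the arrivals in different orders.\<close>

locale stochastic_rewards =
  fixes n m :: nat and E :: "(nat \<times> nat) set" and p :: "nat \<Rightarrow> nat \<Rightarrow> real" and r :: "nat \<Rightarrow> real"
    and \<delta> :: real and S :: "real set" and w :: "real \<Rightarrow> real"
  assumes edges: "E \<subseteq> {..<n} \<times> {..<m}"
    and p_nonneg: "(i, t) \<in> E \<Longrightarrow> 0 \<le> p i t"
    and p_le: "(i, t) \<in> E \<Longrightarrow> p i t \<le> \<delta>"
    and \<delta>_nonneg: "0 \<le> \<delta>" and \<delta>_le: "\<delta> \<le> 1/200"
    and r_pos: "i < n \<Longrightarrow> r i > 0"
    and finite_S: "finite S" and zero_S: "0 \<in> S" and S_nonneg: "x \<in> S \<Longrightarrow> 0 \<le> x"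
    and hazard_sum_S: "T \<subseteq> {..<m} \<Longrightarrow> i < n \<Longrightarrow> sum (hazard E p i) T \<in> S"
    and w_nonneg: "0 \<le> w x"
    and w_tail: "c \<in> S \<Longrightarrow> (\<Sum>x\<in>{x\<in>S. c \<le> x}. w x) = exp (-c)"
    and w_moment_tail: "c \<in> S \<Longrightarrow> (\<Sum>x\<in>{x\<in>S. c \<le> x}. w x * x) \<le> (1 + c) * exp (-c)"
    and w_moment_below: "c \<in> S \<Longrightarrow> (\<Sum>x\<in>{x\<in>S. x < c}. w x * x) \<le> 1 - (1 + c) * exp (-c)"
begin

abbreviation q :: "nat \<Rightarrow> nat \<Rightarrow> real" where "q \<equiv> hazard E p"

section \<open>Hazards compared with probabilities, and valid histories\<close>

lemma exp_minus_q: "(i, t) \<in> E \<Longrightarrow> exp (- q i t) = 1 - p i t"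
  using p_le[of i t] \<delta>_le by (simp add: hazard_def)

lemma p_le_q:
  assumes "(i, t) \<in> E"
  shows "p i t \<le> q i t"
proof -
  have "ln (1 - p i t) \<le> (1 - p i t) - 1" using p_le[OF assms] \<delta>_le by (intro ln_le_minus_one) auto
  then show ?thesis using assms by (simp add: hazard_def)
qed

lemma q_le_p:
  assumes "(i, t) \<in> E"
  shows "q i t \<le> (1 + 2 * \<delta>) * p i t"
proof -
  let ?a = "p i t"
  have a: "0 \<le> ?a" "?a \<le> \<delta>" "\<delta> \<le> 1/200" using p_nonneg p_le \<delta>_le assms by auto
  have "ln (1 / (1 - ?a)) \<le> 1 / (1 - ?a) - 1" using a by (intro ln_le_minus_one) auto
  then have "q i t \<le> ?a / (1 - ?a)" using a assms by (simp add: hazard_def ln_div field_simps)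
  also have "\<dots> \<le> (1 + 2 * \<delta>) * ?a"
  proof -
    have "0 \<le> \<delta> * (1/2 - ?a)" using a by (intro mult_nonneg_nonneg) auto
    then have "1 \<le> (1 + 2 * \<delta>) * (1 - ?a)" using a by (simp add: algebra_simps)
    then have "?a * 1 \<le> ?a * ((1 + 2 * \<delta>) * (1 - ?a))" using a by (intro mult_left_mono) auto
    then show ?thesis using a by (simp add: field_simps)
  qed
  finally show ?thesis .
qed

lemma q_nonneg: "0 \<le> q i t"
  using p_le_q[of i t] p_nonneg[of i t] by (cases "(i, t) \<in> E") (auto simp: hazard_def)

lemma load_q_nonneg: "0 \<le> load q h i"
  unfolding load_def by (intro sum_list_nonneg) (auto simp: q_nonneg)

definition wf :: "history \<Rightarrow> bool" where
  "wf h \<longleftrightarrow> distinct (map fst h) \<and> (\<forall>(t, a, s)\<in>set h. t < m \<and> (\<forall>i. a = Some i \<longrightarrow> (i, t) \<in> E))"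

lemma wf_Nil [simp]: "wf []"
  by (simp add: wf_def)

lemma wf_snoc [simp]:
  "wf (h @ [(t, a, s)]) \<longleftrightarrow> wf h \<and> t < m \<and> t \<notin> processed h \<and> (\<forall>i. a = Some i \<longrightarrow> (i, t) \<in> E)"
  by (auto simp: wf_def processed_def)

lemma wf_edge: "wf h \<Longrightarrow> (t, Some i, s) \<in> set h \<Longrightarrow> (i, t) \<in> E"
  by (auto simp: wf_def)

lemma wf_append: "wf (h @ h') \<Longrightarrow> wf h"
  by (auto simp: wf_def)

lemma load_q_in_S:
  assumes "wf h" "i < n"
  shows "load q h i \<in> S"
proof -
  have "load q h i = sum (q i) {t. (t, Some i, False) \<in> set h}"
    using assms by (intro load_eq_sum) (simp add: wf_def)
  then show ?thesis using hazard_sum_S[of "{t. (t, Some i, False) \<in> set h}" i] assms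
    by (force simp: wf_def)
qed

lemma load_p_bounds:
  assumes "wf h"
  shows "0 \<le> load p h i" "load p h i \<le> load q h i" "load q h i \<le> (1 + 2 * \<delta>) * load p h i"
proof -
  have edge: "(i, t) \<in> E" if "(t, Some i, s) \<in> set h" for t s
    using wf_edge assms that .
  show "0 \<le> load p h i"
    unfolding load_def using edge p_nonneg by (intro sum_list_nonneg) auto
  show "load p h i \<le> load q h i"
    unfolding load_def using edge p_le_q by (intro sum_list_mono) auto
  show "load q h i \<le> (1 + 2 * \<delta>) * load p h i"
    unfolding load_def sum_list_const_mult[symmetric] using edge q_le_p
    by (intro sum_list_mono) auto
qed

section \<open>Deterministic runs driven by the thresholds\<close>

text \<open>The strict comparison makes survival of hazard \<open>H\<close> the event
  \<open>H \<le> B i\<close>, matching the exact tails of \<open>w\<close>. An invalid action stops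
  the run, just as it ends the accumulation in \<open>pval\<close>.\<close>

primrec run :: "nat \<Rightarrow> policy \<Rightarrow> (nat \<Rightarrow> real) \<Rightarrow> history \<Rightarrow> history" where
  "run 0 pol B h = h"
| "run (Suc k) pol B h =
    (case pol h of (t, a) \<Rightarrow>
      if t \<notin> {..<m} - processed h then h else
      (case a of
        None \<Rightarrow> run k pol B (h @ [(t, None, False)])
      | Some i \<Rightarrow>
          if i \<in> avail n h \<and> (i, t) \<in> E then
            run k pol B (h @ [(t, Some i, B i < load q h i + q i t)])
          else h))"

lemma run_invariant:
  assumes "I h"
    and "\<And>h t. I h \<Longrightarrow> t < m \<Longrightarrow> t \<notin> processed h \<Longrightarrow> I (h @ [(t, None, False)])"
    and "\<And>h t i. I h \<Longrightarrow> t < m \<Longrightarrow> t \<notin> processed h \<Longrightarrow> i \<in> avail n h \<Longrightarrow> (i, t) \<in> E \<Longrightarrow>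
      I (h @ [(t, Some i, B i < load q h i + q i t)])"
  shows "I (run k pol B h)"
  using assms(1) by (induction k arbitrary: h) (auto split: prod.splits option.splits intro: assms(2,3))

lemma wf_run: "wf h \<Longrightarrow> wf (run k pol B h)"
  by (rule run_invariant) auto

lemma run_extends: "\<exists>zs. run k pol B h = h @ zs"
  by (rule run_invariant) auto

text \<open>Every offer is credited with its expected reward, whatever its outcome. The expectation
  over the thresholds is unchanged, and the credit splits cleanly into dual variables.\<close>

definition run_value :: "history \<Rightarrow> real" where
  "run_value h = sum_list (map (\<lambda>(t, a, s). case a of None \<Rightarrow> 0 | Some i \<Rightarrow> p i t * r i) h)"

lemma run_value_append [simp]: "run_value (h @ h') = run_value h + run_value h'"
  and run_value_Nil [simp]: "run_value [] = 0"
  and run_value_None [simp]: "run_value [(t, None, s)] = 0"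
  and run_value_Some [simp]: "run_value [(t, Some i, s)] = p i t * r i"
  by (simp_all add: run_value_def)

lemma run_value_eq:
  assumes "wf h"
  shows "run_value h = (\<Sum>i<n. r i * offered (p i) h i)"
proof -
  have "\<forall>(t, a, s)\<in>set h. \<forall>i. a = Some i \<longrightarrow> i < n"
    using wf_edge[OF assms] edges by blast
  then show ?thesis
  proof (induction h)
    case (Cons e h)
    obtain t a s where e: "e = (t, a, s)" by (cases e)
    have "run_value (e # h) = (case a of None \<Rightarrow> 0 | Some i \<Rightarrow> p i t * r i) + run_value h"
      by (simp add: run_value_def e)
    also have "run_value h = (\<Sum>i<n. r i * offered (p i) h i)" using Cons by simp
    also have "(case a of None \<Rightarrow> 0 | Some i \<Rightarrow> p i t * r i)
        = (\<Sum>i<n. r i * (if a = Some i then p i t else 0))"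
    proof (cases a)
      case (Some j)
      then have "(\<Sum>i<n. r i * (if a = Some i then p i t else 0)) = (\<Sum>i<n. if j = i then r i * p i t else 0)"
        by (intro sum.cong) auto
      also have "\<dots> = p j t * r j" using Cons.prems Some e by simp
      finally show ?thesis using Some by simp
    qed simp
    finally show ?case by (simp add: e distrib_left sum.distrib)
  qed simp
qed

text \<open>A valid history contains each arrival at most once, with at most one resource, so no
  arrival is charged twice.\<close>

lemma sum_offered_le:
  assumes "wf h" "\<And>t. t < m \<Longrightarrow> 0 \<le> f t"
  shows "(\<Sum>i<n. offered f h i) \<le> (\<Sum>t<m. f t)"
proof -
  have "(\<Sum>i<n. offered f h i) \<le> sum_list (map f (map fst h))"
    using assms unfolding wf_def
  proof (induction h)
    case (Cons e h)
    obtain t a s where e: "e = (t, a, s)" by (cases e)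
    have t: "0 \<le> f t" using Cons.prems e by auto
    have "(\<Sum>i<n. if a = Some i then f t else 0) \<le> f t"
    proof (cases a)
      case (Some j)
      have "(\<Sum>i<n. if a = Some i then f t else 0) = (\<Sum>i<n. if j = i then f t else 0)"
        using Some by (intro sum.cong) auto
      then show ?thesis using t by simp
    qed (use t in simp)
    moreover have "(\<Sum>i<n. offered f h i) \<le> sum_list (map f (map fst h))" using Cons by auto
    ultimately show ?case by (simp add: e sum.distrib)
  qed simp
  also have "\<dots> = sum f (set (map fst h))"
    using assms by (subst sum_list_distinct_conv_sum_set) (auto simp: wf_def)
  also have "\<dots> \<le> (\<Sum>t<m. f t)"
    using assms by (intro sum_mono2) (auto simp: wf_def)
  finally show ?thesis .
qed

lemma offered_p_nonneg: "wf h \<Longrightarrow> 0 \<le> offered (p i) h i"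
  unfolding offered_def wf_def by (intro sum_list_nonneg) (auto simp: p_nonneg)

text \<open>While \<open>i\<close> is available all its offers have failed, so its hazard is at most
  \<open>B i\<close> and dominates the sum of probabilities. Only the final, successful offer can
  overshoot, by at most \<open>\<delta>\<close>.\<close>

lemma offered_run_le:
  assumes "\<And>j. j < n \<Longrightarrow> 0 \<le> B j" "i < n"
  shows "offered (p i) (run k pol B []) i \<le> B i + \<delta>"
proof -
  define I where "I = (\<lambda>h. offered (p i) h i \<le> B i + \<delta> \<and>
      (i \<in> avail n h \<longrightarrow> offered (p i) h i \<le> load q h i \<and> load q h i \<le> B i))"
  have "I (run k pol B [])"
  proof (rule run_invariant)
    show "I []" using assms \<delta>_nonneg by (auto simp: I_def)
  next
    fix h t assume "I h"
    then show "I (h @ [(t, None, False)])" by (auto simp: I_def)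
  next
    fix h t j assume h: "I h" "j \<in> avail n h" "(j, t) \<in> E"
    show "I (h @ [(t, Some j, B j < load q h j + q j t)])"
      using h p_le[of i t] p_le_q[of i t]
      by (cases "B j < load q h j + q j t"; cases "j = i") (auto simp: I_def)
  qed
  then show ?thesis by (simp add: I_def)
qed

subsection \<open>Independent thresholds\<close>

text \<open>Expectation for independent thresholds with law \<open>w\<close>, as a finite
  sum.\<close>

definition Ex :: "((nat \<Rightarrow> real) \<Rightarrow> real) \<Rightarrow> real" where
  "Ex f = (\<Sum>B\<in>PiE {..<n} (\<lambda>_. S). (\<Prod>i<n. w (B i)) * f B)"

lemma sum_w: "sum w S = 1"
proof -
  have "{x\<in>S. 0 \<le> x} = S" using S_nonneg by auto
  then show ?thesis using w_tail[OF zero_S] by simp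
qed

lemma Ex_mono:
  assumes "\<And>B. (\<And>j. j < n \<Longrightarrow> B j \<in> S) \<Longrightarrow> f B \<le> g B"
  shows "Ex f \<le> Ex g"
  unfolding Ex_def
  by (intro sum_mono mult_left_mono assms prod_nonneg) (auto simp: w_nonneg PiE_def Pi_def)

lemma Ex_cong: "(\<And>B. (\<And>j. j < n \<Longrightarrow> B j \<in> S) \<Longrightarrow> f B = g B) \<Longrightarrow> Ex f = Ex g"
  by (intro antisym Ex_mono) auto

lemma Ex_add: "Ex (\<lambda>B. f B + g B) = Ex f + Ex g"
  by (simp add: Ex_def distrib_left sum.distrib)

lemma Ex_cmult: "Ex (\<lambda>B. c * f B) = c * Ex f"
  by (simp add: Ex_def sum_distrib_left mult.left_commute)

lemma Ex_sum: "Ex (\<lambda>B. \<Sum>i\<in>I. f i B) = (\<Sum>i\<in>I. Ex (f i))"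
  unfolding Ex_def sum_distrib_left by (rule sum.swap)

lemma Ex_const: "Ex (\<lambda>_. c) = c"
  using prod_sum_PiE[of "{..<n}" "\<lambda>_. S" "\<lambda>_. w"] finite_S sum_w
  by (simp add: Ex_def sum_distrib_right[symmetric])

lemma Ex_split:
  assumes "i < n"
  shows "Ex f = (\<Sum>x\<in>S. \<Sum>B\<in>PiE ({..<n} - {i}) (\<lambda>_. S). w x * (\<Prod>j\<in>{..<n} - {i}. w (B j)) * f (B(i := x)))"
proof -
  define A where "A = {..<n} - {i}"
  have A: "{..<n} = insert i A" "i \<notin> A" "finite A" using assms by (auto simp: A_def)
  have P: "(\<Prod>j<n. w ((B(i := x)) j)) = w x * (\<Prod>j\<in>A. w (B j))" for B x
    unfolding A(1) using A(2,3) by (subst prod.insert) (auto intro!: prod.cong)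
  have "Ex f = (\<Sum>B\<in>(\<lambda>(y, g). g(i := y)) ` (S \<times> PiE A (\<lambda>_. S)). (\<Prod>i<n. w (B i)) * f B)"
    unfolding Ex_def using PiE_insert_eq[of i A "\<lambda>_. S"] A(1) by simp
  also have "\<dots> = (\<Sum>(x, B)\<in>S \<times> PiE A (\<lambda>_. S). (\<Prod>j<n. w ((B(i := x)) j)) * f (B(i := x)))"
    by (subst sum.reindex[OF inj_combinator[OF A(2)]]) (simp add: case_prod_unfold)
  finally show ?thesis by (simp add: sum.cartesian_product P A_def[symmetric] del: fun_upd_apply)
qed

text \<open>Redrawing one coordinate of a product law preserves the law. This permits an argument
  with all thresholds but that of \<open>i\<close> fixed.\<close>

lemma Ex_resample:
  assumes "i < n"
  shows "Ex f = Ex (\<lambda>B. \<Sum>x\<in>S. w x * f (B(i := x)))"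
proof -
  let ?P = "PiE ({..<n} - {i}) (\<lambda>_. S)" and ?W = "\<lambda>B. \<Prod>j\<in>{..<n} - {i}. w (B j)"
  have "Ex (\<lambda>B. \<Sum>x\<in>S. w x * f (B(i := x)))
      = (\<Sum>y\<in>S. w y * (\<Sum>B\<in>?P. ?W B * (\<Sum>x\<in>S. w x * f (B(i := x)))))"
    unfolding Ex_split[OF assms] by (simp add: sum_distrib_left mult.assoc)
  also have "\<dots> = (\<Sum>B\<in>?P. ?W B * (\<Sum>x\<in>S. w x * f (B(i := x))))"
    by (simp add: sum_distrib_right[symmetric] sum_w)
  also have "\<dots> = (\<Sum>B\<in>?P. \<Sum>x\<in>S. w x * ?W B * f (B(i := x)))"
    unfolding sum_distrib_left by (simp add: mult_ac)
  also have "\<dots> = Ex f"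
    unfolding Ex_split[OF assms] by (rule sum.swap)
  finally show ?thesis by simp
qed

lemma Ex_indep:
  assumes "i < n" "\<And>B x. f (B(i := x)) = f B"
  shows "Ex (\<lambda>B. u (B i) * f B) = (\<Sum>x\<in>S. w x * u x) * Ex f"
proof -
  have "Ex (\<lambda>B. u (B i) * f B) = Ex (\<lambda>B. \<Sum>x\<in>S. w x * (u x * f B))"
    by (subst Ex_resample[OF assms(1)]) (simp add: assms(2))
  also have "\<dots> = Ex (\<lambda>B. (\<Sum>x\<in>S. w x * u x) * f B)" unfolding sum_distrib_right by (simp add: mult.assoc)
  finally show ?thesis by (simp add: Ex_cmult)
qed

lemma sum_w_tail: "c \<in> S \<Longrightarrow> (\<Sum>x\<in>S. w x * of_bool (c \<le> x)) = exp (-c)"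
proof -
  assume "c \<in> S"
  have "(\<Sum>x\<in>S. w x * of_bool (c \<le> x)) = (\<Sum>x\<in>S. if c \<le> x then w x else 0)"
    by (intro sum.cong) auto
  also have "\<dots> = (\<Sum>x\<in>{x\<in>S. c \<le> x}. w x)" by (rule sum.inter_filter[OF finite_S, symmetric])
  finally show ?thesis using w_tail[OF \<open>c \<in> S\<close>] by simp
qed

section \<open>The threshold model reproduces the original process\<close>

text \<open>Only available resources are constrained: the threshold of a used-up resource no longer
  influences the run.\<close>

definition consistent :: "history \<Rightarrow> (nat \<Rightarrow> real) \<Rightarrow> real" where
  "consistent h B = (\<Prod>i\<in>avail n h. of_bool (load q h i \<le> B i))"

lemma run_indep: "i \<notin> avail n h \<Longrightarrow> run k pol (B(i := x)) h = run k pol B h"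
proof (induction k arbitrary: h)
  case (Suc k)
  define B' where "B' = B(i := x)"
  have "run k pol B' (h @ e) = run k pol B (h @ e)" for e
    using Suc.IH[of "h @ e"] Suc.prems avail_append_subset[of n h e] unfolding B'_def by blast
  moreover have "B' j = B j" if "j \<in> avail n h" for j using that Suc.prems by (auto simp: B'_def)
  ultimately show ?case by (auto simp: B'_def[symmetric] split: prod.splits option.splits)
qed simp

text \<open>Memorylessness: given survival of hazard \<open>H\<close>, the next offer fails with
  probability \<open>exp (- q i t) = 1 - p i t\<close>, as in \<open>pval\<close>. Weighting by
  \<open>consistent h\<close> expresses the conditioning without a division.\<close>

lemma Ex_consistent_run_value:
  assumes "wf h"
  shows "Ex (\<lambda>B. consistent h B * (run_value (run k pol B h) - run_value h))
    = Ex (consistent h) * pval n m E p r k pol h"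
  using assms
proof (induction k arbitrary: h)
  case 0
  then show ?case using Ex_const[of 0] by simp
next
  case (Suc k)
  obtain t a where pol: "pol h = (t, a)" by fastforce
  show ?case
  proof (cases "t \<in> {..<m} - processed h")
    case False
    then show ?thesis using pol Ex_const[of 0] by auto
  next
    case t: True
    then have ne: "{..<m} - processed h \<noteq> {}" by auto
    show ?thesis
    proof (cases a)
      case None
      have c: "consistent (h @ [(t, None, False)]) = consistent h" by (simp add: consistent_def fun_eq_iff)
      have "wf (h @ [(t, None, False)])" using Suc.prems t by simp
      from Suc.IH[OF this] show ?thesis using pol None t ne by (simp add: c)
    next
      case (Some i)
      show ?thesis
      proof (cases "i \<in> avail n h \<and> (i, t) \<in> E")
        case False
        then show ?thesis using pol Some t ne Ex_const[of 0] by auto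
      next
        case True
        then have i: "i < n" "i \<in> avail n h" "(i, t) \<in> E" by (auto simp: avail_def)
        define hs where "hs = h @ [(t, Some i, True)]"
        define hf where "hf = h @ [(t, Some i, False)]"
        define H where "H = load q h i"
        define P where "P = p i t * r i"
        have wf: "wf hs" "wf hf" using Suc.prems t i by (auto simp: hs_def hf_def)
        have "load q hf i = H + q i t" by (simp add: hf_def H_def)
        then have HS: "H \<in> S" "H + q i t \<in> S"
          using load_q_in_S[OF Suc.prems i(1)] load_q_in_S[OF wf(2) i(1)] by (auto simp: H_def)
        have avail: "avail n hs = avail n h - {i}" "avail n hf = avail n h" by (auto simp: hs_def hf_def)
        have fin: "finite (avail n h)" by (rule finite_subset[of _ "{..<n}"]) (auto simp: avail_def)
        have cs: "consistent h B = of_bool (H \<le> B i) * consistent hs B" for B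
          using i fin unfolding consistent_def avail prod.remove[OF fin i(2)] by (simp add: H_def hs_def)
        have cf: "consistent hf B = of_bool (H + q i t \<le> B i) * consistent hs B" for B
        proof -
          have "(\<Prod>j\<in>avail n h - {i}. of_bool (load q hf j \<le> B j) :: real)
             = (\<Prod>j\<in>avail n h - {i}. of_bool (load q hs j \<le> B j))"
            by (intro prod.cong) (auto simp: hf_def hs_def)
          then show ?thesis
            using i fin unfolding consistent_def avail prod.remove[OF fin i(2)] by (simp add: H_def hf_def)
        qed
        have csi: "consistent hs (B(i := x)) = consistent hs B" for B x
          unfolding consistent_def avail by (intro prod.cong) auto
        define F where "F = (\<lambda>h' B. run_value (run k pol B h') - run_value h')"
        have Fi: "F hs (B(i := x)) = F hs B" for B x
          unfolding F_def by (subst run_indep) (auto simp: avail)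
        have ExH: "Ex (\<lambda>B. of_bool (c \<le> B i) * f B) = exp (-c) * Ex f"
          if "c \<in> S" "\<And>B x. f (B(i := x)) = f B" for c f
          using Ex_indep[OF i(1), of f "\<lambda>x. of_bool (c \<le> x)"] that sum_w_tail by simp
        have Ec: "Ex (consistent h) = exp (-H) * Ex (consistent hs)"
          using ExH[OF HS(1), of "consistent hs"] csi by (simp add: cs[abs_def])
        have Ef: "Ex (consistent hf) = exp (-(H + q i t)) * Ex (consistent hs)"
          using ExH[OF HS(2), of "consistent hs"] csi by (simp add: cf[abs_def])
        have expq: "exp (-(H + q i t)) = (1 - p i t) * exp (-H)"
          using exp_minus_q[OF i(3)] exp_add[of "-H" "- q i t"] by (simp add: mult.commute)
        have run: "run_value (run (Suc k) pol B h) - run_value h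
            = P + (if B i < H + q i t then F hs B else F hf B)" for B
          using pol Some t i by (auto simp: F_def hs_def hf_def H_def P_def)
        \<comment> \<open>Success is the event \<open>H \<le> B i < H + q i t\<close>; its indicator
          is written as a difference of two tail indicators, whose expectations factor by
          \<open>ExH\<close>.\<close>
        have "consistent h B * (run_value (run (Suc k) pol B h) - run_value h)
          = P * consistent h B + consistent hf B * F hf B
            + (of_bool (H \<le> B i) * (consistent hs B * F hs B)
               + (-1) * (of_bool (H + q i t \<le> B i) * (consistent hs B * F hs B)))" for B
          unfolding run cs cf using q_nonneg[of i t] by (auto simp: algebra_simps)
        then have "Ex (\<lambda>B. consistent h B * (run_value (run (Suc k) pol B h) - run_value h))
          = P * Ex (consistent h) + Ex (\<lambda>B. consistent hf B * F hf B)
            + (exp (-H) * Ex (\<lambda>B. consistent hs B * F hs B)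
               + (-1) * (exp (-(H + q i t)) * Ex (\<lambda>B. consistent hs B * F hs B)))"
          using ExH[OF HS(1), of "\<lambda>B. consistent hs B * F hs B"]
            ExH[OF HS(2), of "\<lambda>B. consistent hs B * F hs B"]
          by (simp only: Ex_add Ex_cmult csi Fi)
        also have "Ex (\<lambda>B. consistent hf B * F hf B) = Ex (consistent hf) * pval n m E p r k pol hf"
          unfolding F_def using Suc.IH[OF wf(2)] .
        also have "Ex (\<lambda>B. consistent hs B * F hs B) = Ex (consistent hs) * pval n m E p r k pol hs"
          unfolding F_def using Suc.IH[OF wf(1)] .
        also have "P * Ex (consistent h) + Ex (consistent hf) * pval n m E p r k pol hf
            + (exp (-H) * (Ex (consistent hs) * pval n m E p r k pol hs)
               + (-1) * (exp (-(H + q i t)) * (Ex (consistent hs) * pval n m E p r k pol hs)))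
          = Ex (consistent h) * pval n m E p r (Suc k) pol h"
          using pol Some t ne i unfolding Ec Ef expq
          by (simp add: hs_def[symmetric] hf_def[symmetric] P_def algebra_simps)
        finally show ?thesis .
      qed
    qed
  qed
qed

lemma exp_reward_eq: "exp_reward n m E p r pol = Ex (\<lambda>B. run_value (run m pol B []))"
proof -
  have c: "consistent [] B = 1" if "\<And>j. j < n \<Longrightarrow> B j \<in> S" for B
    using that S_nonneg by (simp add: consistent_def)
  have "Ex (consistent []) = Ex (\<lambda>_. 1)" by (intro Ex_cong) (simp add: c)
  moreover have "Ex (\<lambda>B. consistent [] B * (run_value (run m pol B []) - run_value []))
     = Ex (\<lambda>B. run_value (run m pol B []))" by (intro Ex_cong) (simp add: c)
  ultimately show ?thesis
    using Ex_consistent_run_value[OF wf_Nil, of m pol] by (simp add: exp_reward_def Ex_const)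
qed

end

context stochastic_rewards
begin

subsection \<open>The greedy algorithm\<close>

text \<open>The record of arrival \<open>t\<close> then sits at position \<open>t\<close>, and
  \<open>take t h\<close> is the history that the algorithm saw when \<open>t\<close>
  arrived.\<close>

definition in_order :: "history \<Rightarrow> bool" where
  "in_order h \<longleftrightarrow> map fst h = [0..<length h]"

definition offer :: "history \<Rightarrow> nat \<Rightarrow> nat option" where
  "offer h t = fst (snd (h ! t))"

text \<open>The price paid to the arrival \<open>t\<close>, and the rest of the reward \<open>p i t * r i\<close>, kept by \<open>i\<close>.\<close>

definition arrival_dual :: "history \<Rightarrow> nat \<Rightarrow> real" where
  "arrival_dual h t =
    (case offer h t of None \<Rightarrow> 0 | Some i \<Rightarrow> p i t * r i * gfun (load p (take t h) i))"

definition resource_dual :: "nat \<Rightarrow> history \<Rightarrow> nat \<Rightarrow> real" where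
  "resource_dual i h t =
    (if offer h t = Some i then p i t * r i * (1 - gfun (load p (take t h) i)) else 0)"

lemma in_order_snoc: "in_order h \<Longrightarrow> in_order (h @ [(length h, a, s)])"
  by (simp add: in_order_def)

lemma in_order_processed: "in_order h \<Longrightarrow> processed h = {..<length h}"
  by (metis in_order_def processed_def atLeast0LessThan atLeast_upt list.set_map)

lemma wf_take: "wf h \<Longrightarrow> wf (take t h)"
  using wf_append[of "take t h" "drop t h"] by simp

lemma load_take_nonneg: "wf h \<Longrightarrow> 0 \<le> load p (take t h) i"
  by (intro load_p_bounds wf_take)

lemma offer_edge:
  assumes "wf h" "in_order h" "t < length h" "offer h t = Some i"
  shows "(i, t) \<in> E"
proof -
  have "fst (h ! t) = t" using assms by (metis in_order_def nth_map nth_upt add_0 length_map)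
  then have "(t, Some i, snd (snd (h ! t))) = h ! t" using assms by (metis offer_def prod.collapse)
  then show ?thesis using assms wf_edge by (metis nth_mem)
qed

lemma edge_less: "(i, t) \<in> E \<Longrightarrow> i < n \<and> t < m"
  using edges by auto

lemma arrival_dual_nonneg:
  assumes "wf h" "in_order h" "t < length h"
  shows "0 \<le> arrival_dual h t"
  using offer_edge[OF assms] p_nonneg r_pos edge_less load_take_nonneg[OF assms(1)]
  by (auto simp: arrival_dual_def less_imp_le gfun_nonneg split: option.splits intro!: mult_nonneg_nonneg)

lemma resource_dual_nonneg:
  assumes "wf h" "in_order h" "t < length h"
  shows "0 \<le> resource_dual i h t"
  using offer_edge[OF assms] p_nonneg r_pos edge_less load_take_nonneg[OF assms(1)] gfun_le_1
  by (auto simp: resource_dual_def less_imp_le intro!: mult_nonneg_nonneg)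

lemma run_value_eq_duals:
  assumes "wf h" "in_order h"
  shows "run_value h = (\<Sum>t<length h. arrival_dual h t) + (\<Sum>i<n. \<Sum>t<length h. resource_dual i h t)"
proof -
  let ?v = "\<lambda>t. case offer h t of None \<Rightarrow> 0 | Some i \<Rightarrow> p i t * r i"
  have "run_value h = (\<Sum>t<length h. ?v t)"
  proof -
    have fst: "fst (h ! t) = t" if "t < length h" for t
      using that assms by (metis in_order_def nth_map nth_upt add_0 length_map)
    have "(case h ! t of (t, a, s) \<Rightarrow> case a of None \<Rightarrow> 0 | Some i \<Rightarrow> p i t * r i) = ?v t"
      if "t < length h" for t
      using fst[OF that] by (auto simp: offer_def split: prod.splits)
    then show ?thesis
      unfolding run_value_def sum_list_sum_nth by (auto simp: atLeast0LessThan intro!: sum.cong)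
  qed
  also have "\<dots> = (\<Sum>t<length h. arrival_dual h t + (\<Sum>i<n. resource_dual i h t))"
  proof (rule sum.cong)
    fix t assume t: "t \<in> {..<length h}"
    show "?v t = arrival_dual h t + (\<Sum>i<n. resource_dual i h t)"
    proof (cases "offer h t")
      case (Some j)
      have "j < n" using offer_edge[OF assms _ Some] t edge_less by auto
      moreover have "(\<Sum>i<n. resource_dual i h t)
          = (\<Sum>i<n. if j = i then p i t * r i * (1 - gfun (load p (take t h) i)) else 0)"
        using Some by (intro sum.cong) (auto simp: resource_dual_def)
      ultimately have "(\<Sum>i<n. resource_dual i h t) = p j t * r j * (1 - gfun (load p (take t h) j))"
        by simp
      then show ?thesis using Some by (simp add: arrival_dual_def algebra_simps)
    qed (simp add: arrival_dual_def resource_dual_def)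
  qed simp
  also have "\<dots> = (\<Sum>t<length h. arrival_dual h t) + (\<Sum>i<n. \<Sum>t<length h. resource_dual i h t)"
    unfolding sum.distrib by (subst sum.swap[of _ "{..<n}"]) (rule refl)
  finally show ?thesis .
qed

section \<open>Runs of Algorithm 2 and the prices they generate\<close>

context
  fixes alg :: policy
  assumes alg: "alg2 n E p r gfun alg"
begin

definition alg_step :: "(nat \<Rightarrow> real) \<Rightarrow> history \<Rightarrow> history" where
  "alg_step B h = h @ [(length h, snd (alg h),
     case snd (alg h) of None \<Rightarrow> False | Some i \<Rightarrow> B i < load q h i + q i (length h))]"

lemma alg_offer:
  assumes "snd (alg h) = Some i"
  shows "i \<in> avail n h" "(i, length h) \<in> E"
    and "j \<in> avail n h \<Longrightarrow> (j, length h) \<in> E \<Longrightarrow>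
      p j (length h) * r j * gfun (load p h j) \<le> p i (length h) * r i * gfun (load p h i)"
  using alg assms unfolding alg2_def Let_def by (metis (mono_tags, lifting) CollectD CollectI empty_iff option.distinct(1) option.inject)+

lemma alg_no_offer:
  assumes "snd (alg h) = None" "j \<in> avail n h"
  shows "(j, length h) \<notin> E"
  using alg assms unfolding alg2_def Let_def by (metis (mono_tags, lifting) CollectI empty_iff option.distinct(1))

lemma run_alg_Suc:
  assumes "in_order h" "length h < m"
  shows "run (Suc k) alg B h = run k alg B (alg_step B h)"
proof -
  have "alg h = (length h, snd (alg h))" using alg by (metis alg2_def prod.collapse)
  then show ?thesis
    using assms alg_offer[of h] in_order_processed[OF assms(1)]
    by (cases "snd (alg h)") (auto simp: alg_step_def split: prod.splits)
qed

lemma alg_step: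
  assumes "wf h" "in_order h" "length h < m"
  shows "wf (alg_step B h)" "in_order (alg_step B h)" "length (alg_step B h) = Suc (length h)"
  using assms alg_offer[of h] in_order_processed[OF assms(2)]
  by (auto simp: alg_step_def intro: in_order_snoc)

lemma run_alg_complete:
  assumes "wf h" "in_order h" "length h + k = m"
  shows "wf (run k alg B h)" "in_order (run k alg B h)" "length (run k alg B h) = m"
  using assms by (induction k arbitrary: h) (simp_all add: run_alg_Suc alg_step del: run.simps(2))

text \<open>Recovers each greedy decision from the finished run, so that the maximality condition
  can be applied to past arrivals.\<close>

lemma run_alg_nth:
  assumes "wf h" "in_order h" "length h + k = m" "length h \<le> t" "t < m"
  shows "offer (run k alg B h) t = snd (alg (take t (run k alg B h)))"
  using assms
proof (induction k arbitrary: h)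
  case (Suc k)
  have lt: "length h < m" using Suc.prems by simp
  obtain zs where zs: "run (Suc k) alg B h = alg_step B h @ zs"
    using run_extends[of k alg B "alg_step B h"] run_alg_Suc[OF Suc.prems(2) lt] by auto
  show ?case
  proof (cases "t = length h")
    case True
    show ?thesis unfolding zs by (simp add: True alg_step_def offer_def nth_append)
  next
    case False
    then show ?thesis
      unfolding run_alg_Suc[OF Suc.prems(2) lt] using Suc.prems alg_step[OF Suc.prems(1,2) lt]
      by (intro Suc.IH) auto
  qed
qed simp

text \<open>A resource available at the end was available when \<open>t\<close> arrived, so the
  greedy choice scored at least as high as \<open>i\<close>. Its load was then no larger than the
  final one, and \<open>gfun\<close> is decreasing.\<close>

lemma arrival_dual_ge:
  assumes h: "h = run m alg B []" and i: "i \<in> avail n h" and e: "(i, t) \<in> E"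
  shows "p i t * r i * gfun (load p h i) \<le> arrival_dual h t"
proof -
  have t: "t < m" using edge_less[OF e] by simp
  have wf: "wf h" "in_order h" "length h = m"
    unfolding h by (rule run_alg_complete; simp add: in_order_def)+
  define h' where "h' = take t h"
  have len: "length h' = t" using wf t by (simp add: h'_def)
  have hh: "h = h' @ drop t h" by (simp add: h'_def)
  have wf': "wf h'" unfolding h'_def by (rule wf_take[OF wf(1)])
  have i': "i \<in> avail n h'" using i hh avail_append_subset by (metis subsetD)
  have "0 \<le> load p (drop t h) i"
    unfolding load_def using wf_edge[OF wf(1)] p_nonneg
    by (intro sum_list_nonneg) (auto dest!: in_set_dropD)
  then have "load p h' i \<le> load p h i" by (subst hh) simp
  then have g: "gfun (load p h i) \<le> gfun (load p h' i)"
    using load_p_bounds(1)[OF wf'] by (intro gfun_antimono)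
  have off: "offer h t = snd (alg h')"
    unfolding h'_def h by (rule run_alg_nth) (use t in \<open>auto simp: in_order_def\<close>)
  obtain j where j: "snd (alg h') = Some j"
    using alg_no_offer[of h' i] i' e len by (cases "snd (alg h')") auto
  have "p i t * r i * gfun (load p h i) \<le> p i t * r i * gfun (load p h' i)"
    using g p_nonneg[OF e] r_pos[of i] edge_less[OF e] by (intro mult_left_mono) auto
  also have "\<dots> \<le> p j t * r j * gfun (load p h' j)"
    using alg_offer(3)[OF j i'] e len by simp
  finally show ?thesis using off j by (simp add: arrival_dual_def h'_def)
qed

text \<open>Fix all thresholds but that of \<open>i\<close>. With threshold \<open>Max S\<close>, \<open>i\<close> is never used up; with
  threshold \<open>x\<close>, the run is the same until the hazard of \<open>i\<close> exceeds \<open>x\<close>.\<close>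

context
  fixes i :: nat and B :: "nat \<Rightarrow> real"
  assumes i: "i < n"
begin

abbreviation alg_run :: "nat \<Rightarrow> real \<Rightarrow> history \<Rightarrow> history" where
  "alg_run k x h \<equiv> run k alg (B(i := x)) h"

lemma alg_step_other:
  assumes "snd (alg h) \<noteq> Some i"
  shows "alg_step (B(i := x)) h = alg_step B h" "i \<in> avail n (alg_step B h) \<longleftrightarrow> i \<in> avail n h"
    "load q (alg_step B h) i = load q h i"
  using assms by (auto simp: alg_step_def avail_def split: option.splits)

lemma alg_step_same:
  assumes "snd (alg h) = Some i"
  shows "alg_step (B(i := x)) h = h @ [(length h, Some i, x < load q h i + q i (length h))]"
  using assms by (auto simp: alg_step_def)

lemma load_q_run_ge: "load q h i \<le> load q (run k pol B' h) i"
  using run_extends[of k pol B' h] load_q_nonneg by fastforce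

lemma load_q_le_Max: "wf h \<Longrightarrow> load q h i \<le> Max S"
  using load_q_in_S i finite_S by simp

lemma wf_alg_step_fail:
  assumes "wf h" "in_order h" "length h < m" "snd (alg h) = Some i"
  shows "wf (h @ [(length h, Some i, s)])"
  using assms alg_offer in_order_processed[OF assms(2)] by simp

text \<open>Every attainable hazard lies in \<open>S\<close>, so none exceeds
  \<open>Max S\<close>.\<close>

lemma alg_run_Max_avail:
  assumes "wf h" "i \<in> avail n h"
  shows "i \<in> avail n (alg_run k (Max S) h)"
proof -
  have "wf (alg_run k (Max S) h) \<and> i \<in> avail n (alg_run k (Max S) h)"
  proof (rule run_invariant)
    fix h t j assume h: "wf h \<and> i \<in> avail n h" "t < m" "t \<notin> processed h" "(j, t) \<in> E"
    have "load q (h @ [(t, Some j, False)]) i \<le> Max S"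
      using h by (intro load_q_le_Max) auto
    then have "\<not> (B(i := Max S)) j < load q h j + q j t" if "j = i" using that by simp
    then show "wf (h @ [(t, Some j, (B(i := Max S)) j < load q h j + q j t)]) \<and>
        i \<in> avail n (h @ [(t, Some j, (B(i := Max S)) j < load q h j + q j t)])"
      using h by (cases "(B(i := Max S)) j < load q h j + q j t"; cases "j = i") (simp_all del: fun_upd_apply)
  qed (use assms in auto)
  then show ?thesis by simp
qed

text \<open>The hazard of \<open>i\<close> only grows along the run with \<open>Max S\<close>. If it
  ends at most at \<open>x\<close>, every offer of \<open>i\<close> fails under both
  thresholds.\<close>

lemma alg_run_eq_Max:
  assumes "wf h" "in_order h" "length h + k = m" "load q (alg_run k (Max S) h) i \<le> x"
  shows "alg_run k x h = alg_run k (Max S) h"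
  using assms
proof (induction k arbitrary: h)
  case (Suc k)
  have lt: "length h < m" using Suc.prems by simp
  note run = run_alg_Suc[OF Suc.prems(2) lt]
  have step: "alg_step (B(i := x)) h = alg_step (B(i := Max S)) h"
  proof (cases "snd (alg h) = Some i")
    case True
    define hf where "hf = h @ [(length h, Some i, False)]"
    have "wf hf" unfolding hf_def by (rule wf_alg_step_fail[OF Suc.prems(1,2) lt True])
    then have M: "load q h i + q i (length h) \<le> Max S" using load_q_le_Max[of hf] by (simp add: hf_def)
    then have "alg_step (B(i := Max S)) h = hf" by (simp add: alg_step_same[OF True] hf_def)
    then have "load q hf i \<le> load q (alg_run (Suc k) (Max S) h) i"
      unfolding run by (simp add: load_q_run_ge)
    from order_trans[OF this Suc.prems(4)] have "load q h i + q i (length h) \<le> x" by (simp add: hf_def)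
    then show ?thesis using M by (simp add: alg_step_same[OF True])
  qed (simp add: alg_step_other)
  show ?case unfolding run step
    by (rule Suc.IH) (use Suc.prems alg_step[OF Suc.prems(1,2) lt] in \<open>simp_all add: run del: run.simps(2) fun_upd_apply\<close>)
qed simp

text \<open>An offer of \<open>i\<close> at hazard \<open>H\<close> occurs exactly for thresholds
  \<open>x \<ge> H\<close>, of total weight \<open>exp (-H)\<close>, so its averaged dual covers the
  drop of \<open>U\<close> over that step; the drops telescope along the run with
  \<open>Max S\<close>. \<open>U\<close> is kept general because two potentials are used.\<close>

lemma resource_dual_potential:
  fixes U :: "real \<Rightarrow> real"
  assumes U: "\<And>a A H. 0 \<le> a \<Longrightarrow> a \<le> \<delta> \<Longrightarrow> 0 \<le> A \<Longrightarrow> A \<le> H \<Longrightarrow> H \<le> (1 + 2 * \<delta>) * A \<Longrightarrow>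
      U H - U (H - ln (1 - a)) \<le> a * (1 - gfun A) * exp (-H)"
    and h: "wf h" "in_order h" "length h + k = m" "i \<in> avail n h"
  shows "r i * (U (load q h i) - U (load q (alg_run k (Max S) h) i))
    \<le> (\<Sum>x\<in>{x\<in>S. load q h i \<le> x}. w x * (\<Sum>t\<in>{length h..<m}. resource_dual i (alg_run k x h) t))"
  using h
proof (induction k arbitrary: h)
  case 0
  then show ?case by simp
next
  case (Suc k)
  have lt: "length h < m" using Suc.prems by simp
  note run = run_alg_Suc[OF Suc.prems(2) lt]
  note step = alg_step[OF Suc.prems(1,2) lt]
  define rest where "rest = (\<lambda>x. \<Sum>t\<in>{Suc (length h)..<m}. resource_dual i (alg_run (Suc k) x h) t)"
  have sum: "(\<Sum>t\<in>{length h..<m}. resource_dual i (alg_run (Suc k) x h) t)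
      = resource_dual i (alg_run (Suc k) x h) (length h) + rest x" for x
    unfolding rest_def by (rule sum.atLeast_Suc_lessThan[OF lt])
  have first: "resource_dual i (alg_run (Suc k) x h) (length h)
    = (if snd (alg h) = Some i then p i (length h) * r i * (1 - gfun (load p h i)) else 0)" for x
  proof -
    obtain zs where "alg_run (Suc k) x h = alg_step (B(i := x)) h @ zs"
      unfolding run using run_extends by blast
    then show ?thesis
      by (simp add: resource_dual_def offer_def alg_step_def nth_append del: run.simps(2) fun_upd_apply)
  qed
  show ?case
  proof (cases "snd (alg h) = Some i")
    case False
    note other = alg_step_other[OF False]
    have "r i * (U (load q (alg_step B h) i) - U (load q (alg_run k (Max S) (alg_step B h)) i))
      \<le> (\<Sum>x\<in>{x\<in>S. load q (alg_step B h) i \<le> x}.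
          w x * (\<Sum>t\<in>{length (alg_step B h)..<m}. resource_dual i (alg_run k x (alg_step B h)) t))"
      by (rule Suc.IH) (use Suc.prems step other in simp_all)
    then show ?thesis
      unfolding sum first rest_def unfolding run other(1) by (simp add: other step False)
  next
    case True
    define t where "t = length h"
    define H where "H = load q h i"
    define hf where "hf = h @ [(t, Some i, False)]"
    define c where "c = p i t * r i * (1 - gfun (load p h i))"
    have e: "(i, t) \<in> E" using alg_offer(2)[OF True] by (simp add: t_def)
    have hf: "wf hf" "in_order hf" "length hf = Suc t" "i \<in> avail n hf" "load q hf i = H + q i t"
      using wf_alg_step_fail[OF Suc.prems(1,2) lt True] Suc.prems in_order_snoc
      by (simp_all add: hf_def t_def H_def)
    have HS: "H \<in> S" "H + q i t \<in> S"
      using load_q_in_S[OF Suc.prems(1) i] load_q_in_S[OF hf(1) i] hf(5) by (simp_all add: H_def)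
    have late: "alg_step (B(i := x)) h = hf" if "H + q i t \<le> x" for x
      using that by (simp add: alg_step_same[OF True] hf_def H_def t_def)
    have M: "alg_run (Suc k) (Max S) h = alg_run k (Max S) hf"
      unfolding run using late[of "Max S"] HS finite_S by simp
    have "r i * (U (load q hf i) - U (load q (alg_run k (Max S) hf) i))
      \<le> (\<Sum>x\<in>{x\<in>S. load q hf i \<le> x}. w x * (\<Sum>t\<in>{length hf..<m}. resource_dual i (alg_run k x hf) t))"
      by (rule Suc.IH) (use Suc.prems hf in \<open>simp_all add: t_def\<close>)
    also have "\<dots> = (\<Sum>x\<in>{x\<in>S. H + q i t \<le> x}. w x * rest x)"
      unfolding hf(5) rest_def run hf(3) t_def[symmetric] by (intro sum.cong) (auto simp: late)
    \<comment> \<open>For thresholds between \<open>H\<close> and \<open>H + q i t\<close> the offer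
      succeeds; nonnegativity of the later duals is enough there.\<close>
    also have "\<dots> \<le> (\<Sum>x\<in>{x\<in>S. H \<le> x}. w x * rest x)"
    proof (intro sum_mono2)
      show "0 \<le> w x * rest x" for x
        unfolding rest_def using run_alg_complete[OF Suc.prems(1-3)]
        by (intro mult_nonneg_nonneg sum_nonneg resource_dual_nonneg w_nonneg) auto
    qed (use finite_S q_nonneg[of i t] in auto)
    finally have IH: "r i * (U (H + q i t) - U (load q (alg_run k (Max S) hf) i))
       \<le> (\<Sum>x\<in>{x\<in>S. H \<le> x}. w x * rest x)" unfolding hf(5) .
    have "U H - U (H - ln (1 - p i t)) \<le> p i t * (1 - gfun (load p h i)) * exp (-H)"
      using load_p_bounds[OF Suc.prems(1), of i] p_nonneg[OF e] p_le[OF e]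
      by (intro U) (simp_all add: H_def)
    then have "r i * (U H - U (H + q i t)) \<le> r i * (p i t * (1 - gfun (load p h i)) * exp (-H))"
      using e r_pos[OF i] by (simp add: hazard_def)
    also have "\<dots> = (\<Sum>x\<in>{x\<in>S. H \<le> x}. w x * c)"
      by (simp add: sum_distrib_right[symmetric] w_tail[OF HS(1)] c_def)
    finally have "r i * (U H - U (H + q i t)) \<le> (\<Sum>x\<in>{x\<in>S. H \<le> x}. w x * c)" .
    with IH have "r i * (U H - U (load q (alg_run k (Max S) hf) i))
      \<le> (\<Sum>x\<in>{x\<in>S. H \<le> x}. w x * c) + (\<Sum>x\<in>{x\<in>S. H \<le> x}. w x * rest x)"
      by (simp add: right_diff_distrib)
    also have "\<dots> = (\<Sum>x\<in>{x\<in>S. H \<le> x}. w x * (c + rest x))" by (simp add: distrib_left sum.distrib)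
    finally show ?thesis
      unfolding sum first M using True by (simp add: H_def c_def t_def)
  qed
qed

text \<open>Instantiates the single-resource inequality: two potentials bound the dual of
  \<open>i\<close> from below, and its threshold bounds the offline use.\<close>

lemma resource_bound:
  "gfun 0 * (1 - 9 * \<delta>) * r i * (\<Sum>x\<in>S. w x * offered (p i) (run m pol (B(i := x)) []) i)
   \<le> (\<Sum>x\<in>S. w x * ((\<Sum>t<m. resource_dual i (alg_run m x []) t)
        + offered (arrival_dual (alg_run m x [])) (run m pol (B(i := x)) []) i))"
  if B: "\<And>j. j < n \<Longrightarrow> B j \<in> S"
proof -
  define hM where "hM = alg_run m (Max S) []"
  define Q where "Q = load q hM i"
  define L where "L = load p hM i"
  define Y where "Y = (\<lambda>x. offered (p i) (run m pol (B(i := x)) []) i)"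
  define \<theta> where "\<theta> = (\<Sum>x\<in>S. w x * (\<Sum>t<m. resource_dual i (alg_run m x []) t))"
  have nil: "wf []" "in_order []" "length [] + m = m" "i \<in> avail n []" using i by (auto simp: in_order_def)
  have wfM: "wf hM" unfolding hM_def by (rule run_alg_complete(1)[OF nil(1-3)])
  have avM: "i \<in> avail n hM" unfolding hM_def by (rule alg_run_Max_avail[OF nil(1,4)])
  have all: "{x\<in>S. load q [] i \<le> x} = S" using S_nonneg by auto
  have pot: "r i * (U 0 - U Q) \<le> \<theta>"
    if "\<And>a A H. 0 \<le> a \<Longrightarrow> a \<le> \<delta> \<Longrightarrow> 0 \<le> A \<Longrightarrow> A \<le> H \<Longrightarrow> H \<le> (1 + 2 * \<delta>) * A \<Longrightarrow>
      U H - U (H - ln (1 - a)) \<le> a * (1 - gfun A) * exp (-H)" for U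
    using resource_dual_potential[OF that nil] unfolding all
    by (simp add: Q_def hM_def \<theta>_def atLeast0LessThan)
  have ri: "r i > 0" by (rule r_pos[OF i])
  have \<delta>4: "\<delta> \<le> 1/4" using \<delta>_le by simp
  \<comment> \<open>At 0 the correction in the potential equals \<open>4 * \<delta>\<close>; its
    value at \<open>Q\<close> is nonnegative and is dropped.\<close>
  have "r i * (gfun 0 - (1 + Q) * exp (-Q) * gfun Q - 4 * \<delta>) \<le> r i * (gfun 0 - 2 * \<delta> * 2
      - ((1 + Q) * exp (-Q) * gfun Q - 2 * \<delta> * ((2 + Q) * exp (-Q))))"
    using ri \<delta>_nonneg load_q_nonneg[of hM i] by (intro mult_left_mono) (auto simp: Q_def)
  also have "\<dots> \<le> \<theta>"
    using pot[of "\<lambda>x. (1 + x) * exp (-x) * gfun x - 2 * \<delta> * ((2 + x) * exp (-x))"]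
      gfun_step(1)[OF _ _ \<delta>4] by simp
  finally have \<theta>1: "gfun 0 - (1 + Q) * exp (-Q) * gfun Q - 4 * \<delta> \<le> \<theta> / r i"
    using ri by (simp add: pos_le_divide_eq mult.commute)
  have "r i * ((1 - gfun 0) * (1 - exp (-Q))) \<le> \<theta>"
    using pot[of "\<lambda>x. (1 - gfun 0) * exp (-x)"] gfun_step(2)[OF _ _ \<delta>4]
    by (simp add: right_diff_distrib)
  then have \<theta>2: "(1 - gfun 0) * (1 - exp (-Q)) \<le> \<theta> / r i"
    using ri by (simp add: pos_le_divide_eq mult.commute)
  have Y: "0 \<le> Y x" "Y x \<le> x + \<delta>" if "x \<in> S" for x
    using offered_p_nonneg[OF wf_run[OF wf_Nil]] offered_run_le[of "B(i := x)" i m pol] i that B S_nonneg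
    by (auto simp: Y_def)
  have "gfun 0 * (1 - 9 * \<delta>) * (\<Sum>x\<in>S. w x * Y x)
     \<le> \<theta> / r i + gfun L * (\<Sum>x\<in>{x\<in>S. Q \<le> x}. w x * Y x)"
    using load_p_bounds[OF wfM, of i] load_q_in_S[OF wfM i]
    by (intro single_resource_bound[OF finite_S zero_S S_nonneg w_nonneg w_tail w_moment_tail
          w_moment_below \<delta>_nonneg \<delta>_le _ _ _ _ Y \<theta>1 \<theta>2]) (auto simp: Q_def L_def)
  then have "r i * (gfun 0 * (1 - 9 * \<delta>) * (\<Sum>x\<in>S. w x * Y x))
     \<le> r i * (\<theta> / r i + gfun L * (\<Sum>x\<in>{x\<in>S. Q \<le> x}. w x * Y x))"
    using ri by (intro mult_left_mono) auto
  also have "\<dots> = \<theta> + (\<Sum>x\<in>{x\<in>S. Q \<le> x}. w x * (r i * gfun L * Y x))"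
    using ri by (simp add: distrib_left sum_distrib_left mult_ac)
  also have "\<dots> \<le> \<theta> + (\<Sum>x\<in>S. w x * offered (arrival_dual (alg_run m x [])) (run m pol (B(i := x)) []) i)"
  proof -
    let ?o = "\<lambda>x. offered (arrival_dual (alg_run m x [])) (run m pol (B(i := x)) []) i"
    have "(\<Sum>x\<in>{x\<in>S. Q \<le> x}. w x * (r i * gfun L * Y x)) \<le> (\<Sum>x\<in>{x\<in>S. Q \<le> x}. w x * ?o x)"
    proof (intro sum_mono mult_left_mono w_nonneg)
      fix x assume x: "x \<in> {x\<in>S. Q \<le> x}"
      \<comment> \<open>Above \<open>Q\<close> the prices do not depend on \<open>x\<close>,
        although the offline run still does.\<close>
      have eq: "alg_run m x [] = hM" unfolding hM_def
        by (rule alg_run_eq_Max[OF nil(1-3)]) (use x in \<open>simp add: Q_def hM_def\<close>)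
      have wf: "wf (run m pol (B(i := x)) [])" by (rule wf_run[OF wf_Nil])
      have "r i * gfun L * Y x = sum_list (map (\<lambda>e. r i * gfun L * (case e of (t, a, s) \<Rightarrow>
          if a = Some i then p i t else 0)) (run m pol (B(i := x)) []))"
        unfolding Y_def offered_def by (rule sum_list_const_mult[symmetric])
      also have "\<dots> \<le> offered (arrival_dual hM) (run m pol (B(i := x)) []) i"
        unfolding offered_def
      proof (rule sum_list_mono)
        fix e assume e: "e \<in> set (run m pol (B(i := x)) [])"
        obtain t a s where "e = (t, a, s)" by (cases e)
        then show "r i * gfun L * (case e of (t, a, s) \<Rightarrow> if a = Some i then p i t else 0)
          \<le> (case e of (t, a, s) \<Rightarrow> if a = Some i then arrival_dual hM t else 0)"
          using arrival_dual_ge[OF hM_def avM, of t] wf_edge[OF wf, of t i s] e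
          by (auto simp: L_def mult_ac)
      qed
      finally show "r i * gfun L * Y x \<le> ?o x" by (simp add: eq)
    qed
    also have "\<dots> \<le> (\<Sum>x\<in>S. w x * ?o x)"
    proof (intro sum_mono2)
      fix x
      have wf: "wf (run m pol (B(i := x)) [])" by (rule wf_run[OF wf_Nil])
      have "0 \<le> arrival_dual (alg_run m x []) t" if "t < m" for t
        using run_alg_complete[OF nil(1-3)] that by (intro arrival_dual_nonneg) auto
      then have "0 \<le> ?o x"
        unfolding offered_def using wf by (intro sum_list_nonneg) (auto simp: wf_def)
      then show "0 \<le> w x * ?o x" using w_nonneg by simp
    qed (use finite_S in auto)
    finally show ?thesis by simp
  qed
  finally show ?thesis unfolding \<theta>_def Y_def by (simp add: distrib_left sum.distrib mult_ac)
qed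

end

text \<open>Weak duality: \<open>resource_bound\<close> is averaged over the thresholds and summed
  over \<open>i\<close>. The prices charged to the offline run total at most those of all arrivals,
  and together with the resource duals they make up the algorithm's value.\<close>

lemma alg_reward_ge:
  "gfun 0 * (1 - 9 * \<delta>) * exp_reward n m E p r pol \<le> exp_reward n m E p r alg"
proof -
  define hA where "hA = (\<lambda>B. run m alg B [])"
  define hO where "hO = (\<lambda>B. run m pol B [])"
  define \<beta> where "\<beta> = gfun 0 * (1 - 9 * \<delta>)"
  define f where "f = (\<lambda>i B. (\<Sum>t<m. resource_dual i (hA B) t) + offered (arrival_dual (hA B)) (hO B) i)"
  have A: "wf (hA B)" "in_order (hA B)" "length (hA B) = m" for B
    unfolding hA_def by (rule run_alg_complete; simp add: in_order_def)+
  have O: "wf (hO B)" for B unfolding hO_def by (rule wf_run[OF wf_Nil])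
  have "\<beta> * exp_reward n m E p r pol = \<beta> * (\<Sum>i<n. Ex (\<lambda>B. r i * offered (p i) (hO B) i))"
    by (simp add: exp_reward_eq hO_def run_value_eq[OF wf_run[OF wf_Nil]] Ex_sum)
  also have "\<dots> = (\<Sum>i<n. Ex (\<lambda>B. \<beta> * r i * offered (p i) (hO B) i))"
    by (simp add: sum_distrib_left Ex_cmult mult.assoc)
  also have "\<dots> \<le> (\<Sum>i<n. Ex (f i))"
  proof (rule sum_mono)
    fix i assume "i \<in> {..<n}"
    then have i: "i < n" by simp
    have "Ex (\<lambda>B. \<beta> * r i * offered (p i) (hO B) i)
      = \<beta> * r i * Ex (\<lambda>B. \<Sum>x\<in>S. w x * offered (p i) (hO (B(i := x))) i)"
      by (simp only: Ex_cmult Ex_resample[OF i, of "\<lambda>B. offered (p i) (hO B) i"])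
    also have "\<dots> = Ex (\<lambda>B. \<beta> * r i * (\<Sum>x\<in>S. w x * offered (p i) (hO (B(i := x))) i))"
      by (simp only: Ex_cmult)
    also have "\<dots> \<le> Ex (\<lambda>B. \<Sum>x\<in>S. w x * f i (B(i := x)))"
      unfolding f_def hA_def hO_def \<beta>_def by (intro Ex_mono resource_bound i)
    also have "\<dots> = Ex (f i)" by (rule Ex_resample[OF i, symmetric])
    finally show "Ex (\<lambda>B. \<beta> * r i * offered (p i) (hO B) i) \<le> Ex (f i)" .
  qed
  also have "\<dots> = Ex (\<lambda>B. \<Sum>i<n. f i B)" by (rule Ex_sum[symmetric])
  also have "\<dots> \<le> Ex (\<lambda>B. run_value (hA B))"
  proof (rule Ex_mono)
    fix B
    have "(\<Sum>i<n. offered (arrival_dual (hA B)) (hO B) i) \<le> (\<Sum>t<m. arrival_dual (hA B) t)"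
      using A by (intro sum_offered_le O arrival_dual_nonneg) auto
    then show "(\<Sum>i<n. f i B) \<le> run_value (hA B)"
      using run_value_eq_duals[OF A(1,2), of B] by (simp add: f_def sum.distrib A(3))
  qed
  also have "\<dots> = exp_reward n m E p r alg" by (simp add: exp_reward_eq hA_def)
  finally show ?thesis by (simp add: \<beta>_def)
qed

end

end

section \<open>Choice of the constant and of the threshold set\<close>

theorem theorem2:
  shows "(\<exists>C > 0. \<forall>(n::nat) (m::nat) (E::(nat \<times> nat) set) (p::nat \<Rightarrow> nat \<Rightarrow> real) (r::nat \<Rightarrow> real).
            E \<subseteq> {..<n} \<times> {..<m} \<longrightarrow>
            (\<forall>(i, t) \<in> E. 0 \<le> p i t \<and> p i t \<le> 1) \<longrightarrow>
            (\<forall>i < n. r i > 0) \<longrightarrow>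
            (\<forall>alg. alg2 n E p r gfun alg \<longrightarrow>
              (\<forall>pol. exp_reward n m E p r alg
                       \<ge> (1 - C * sqrt (pmax E p)) * gfun 0 * exp_reward n m E p r pol) \<and>
              (\<forall>pol. clairvoyant pol \<longrightarrow> exp_reward n m E p r alg
                       \<ge> (1 - C * sqrt (pmax E p)) * gfun 0 * exp_reward n m E p r pol)))
         \<and> gfun 0 > 0.596"
proof -
  have bound: "(1 - 15 * sqrt (pmax E p)) * gfun 0 * exp_reward n m E p r pol \<le> exp_reward n m E p r alg"
    if E: "E \<subseteq> {..<n} \<times> {..<m}" and p: "\<forall>(i, t)\<in>E. 0 \<le> p i t \<and> p i t \<le> 1"
      and r: "\<forall>i<n. r i > 0" and alg: "alg2 n E p r gfun alg"
    for n m :: nat and E p r alg pol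
  proof -
    define \<delta> where "\<delta> = pmax E p"
    have nonneg: "0 \<le> exp_reward n m E p r pol'" for pol'
      unfolding exp_reward_def by (rule pval_nonneg[OF p r])
    have finE: "finite E" using E finite_subset by blast
    have le: "p i t \<le> \<delta>" if "(i, t) \<in> E" for i t
      using that finE unfolding \<delta>_def pmax_def by (auto intro!: Max_ge)
    have \<delta>0: "0 \<le> \<delta>"
    proof (cases "E = {}")
      case False
      then obtain i t where "(i, t) \<in> E" by auto
      then show ?thesis using le p by force
    qed (simp add: \<delta>_def pmax_def)
    show ?thesis
    \<comment> \<open>With the constant 15 the claim is trivial unless
      \<open>\<delta> < 1/225\<close>, which gives the required \<open>\<delta> \<le> 1/200\<close>;
      then \<open>9 * \<delta> \<le> 15 * sqrt \<delta>\<close>.\<close>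
    proof (cases "15 * sqrt \<delta> \<ge> 1")
      case True
      then have "(1 - 15 * sqrt \<delta>) * (gfun 0 * exp_reward n m E p r pol) \<le> 0"
        using nonneg gfun_nonneg[of 0] by (intro mult_nonpos_nonneg) auto
      then show ?thesis using nonneg[of alg] by (simp add: \<delta>_def mult.assoc)
    next
      case False
      have sq: "sqrt \<delta> * sqrt \<delta> = \<delta>" using \<delta>0 by simp
      have s: "0 \<le> sqrt \<delta>" "sqrt \<delta> \<le> 1/15" using False \<delta>0 by auto
      then have "sqrt \<delta> * sqrt \<delta> \<le> 1/15 * (1/15)" by (intro mult_mono) auto
      then have \<delta>1: "\<delta> \<le> 1/200" unfolding sq by simp
      have "sqrt \<delta> * sqrt \<delta> \<le> sqrt \<delta> * 1" using s by (intro mult_left_mono) linarith+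
      then have \<delta>s: "\<delta> \<le> sqrt \<delta>" unfolding sq by simp
      have hazard_nonneg: "0 \<le> hazard E p i t" for i t
        using p le[of i t] \<delta>1 by (force simp: hazard_def)
      \<comment> \<open>All subset sums of hazards; 0 is inserted separately because the image is
        empty when \<open>n = 0\<close>.\<close>
      define S where "S = insert 0 ((\<lambda>(T, i). sum (hazard E p i) T) ` (Pow {..<m} \<times> {..<n}))"
      have S: "finite S" "0 \<in> S" "\<And>x. x \<in> S \<Longrightarrow> 0 \<le> x"
        by (auto simp: S_def intro!: sum_nonneg hazard_nonneg)
      then have "Min S = 0" by (intro Min_eqI)
      then obtain w where w: "\<forall>x. 0 \<le> w x"
        "\<forall>c\<in>S. (\<Sum>x\<in>{x\<in>S. c \<le> x}. w x) = exp (-c)"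
        "\<forall>c\<in>S. (\<Sum>x\<in>{x\<in>S. c \<le> x}. w x * x) \<le> (1 + c) * exp (-c)"
        "\<forall>c\<in>S. (\<Sum>x\<in>{x\<in>S. x < c}. w x * x) \<le> 1 - (1 + c) * exp (-c)"
        using exponential_weights[OF S(1)] S(2) by force
      interpret stochastic_rewards n m E p r \<delta> S w
        by unfold_locales (use E p r le \<delta>0 \<delta>1 S w in \<open>auto simp: S_def\<close>)
      have "(1 - 15 * sqrt \<delta>) * (gfun 0 * exp_reward n m E p r pol)
          \<le> (1 - 9 * \<delta>) * (gfun 0 * exp_reward n m E p r pol)"
        using \<delta>s s \<delta>0 \<delta>1 nonneg gfun_nonneg[of 0] by (intro mult_right_mono) auto
      also have "\<dots> \<le> exp_reward n m E p r alg"
        using alg_reward_ge[OF alg, of pol] by (simp add: mult_ac)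
      finally show ?thesis by (simp add: \<delta>_def mult.assoc)
    qed
  qed
  show ?thesis
    by (intro conjI exI[of _ 15] allI impI bound gfun_0_gt) simp_all
qed

end
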